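(* Let $k\ge1$ be an integer. There is a constant $c_k>0$ depending only on $k$ such that the following holds. Let $D_1=(d_{1,1},\dots,d_{1,n_1})$ and $D_2=(d_{2,1},\dots,d_{2,n_2})$ be vectors of positive integers such that the polytope $\mathbb P^{D_1,D_2}$ has a non-empty interior, and let $n=n_1+n_2$. Then $$L_{\mathbf b}(k,D_1,D_2):=\frac1M\sum_{(s,T)\in\mathcal T_{\mathbf b}(k,n)}\frac{1}{\psi(s,T,D)}\left|\mathbf p_{\mathbf b}(s,T)-\widetilde{\mathbf p}(s,T)\right|$$ satisfies $$L_{\mathbf b}(k,D_1,D_2)\le c_k\cdot\left(\frac{n\log n}{M}\right)^{\frac12}.$$
   Context: Bipartite graphs here have a vertex set of size $n=n_1+n_2$, identified with $[n]=\{1,\dots,n\}$ and split into set 1 (of size $n_1$) and set 2 (of size $n_2$), with no edge having both ends in the same set. Given integer vectors $D_i=(d_{i,1},\dots,d_{i,n_i})$, $d_{i,1}\le\dots\le d_{i,n_i}$ for $i=1,2$, with $\sum_i d_{1,i}=\sum_j d_{2,j}$, let $\mathbb G^{D_1,D_2}$ be the set of (simple) bipartite graphs in which the vertices of set 1 have degrees $D_1$ and the vertices of set 2 have degrees $D_2$. $\mathcal G_{\mathbf b}(D_1,D_2)$ is a uniformly random element of $\mathbb G^{D_1,D_2}$. Write $D=(D_1,D_2)=(d_v)_{v\in[n]}$ for the combined degree vector and $M=\sum_{v\in[n]}d_v$. $\mathbb P^{D_1,D_2}$ is the polytope of $n_1\times n_2$ matrices $X=(x_{ij})$ with $0\le x_{ij}\le1$,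 $\sum_{j=1}^{n_2}x_{ij}=d_{1,i}$ for $1\le i\le n_1$ and $\sum_{i=1}^{n_1}x_{ij}=d_{2,j}$ for $1\le j\le n_2$. "Non-empty interior" means that it contains a point with $0<x_{ij}<1$ for all $i,j$. With $H(x)=-x\ln x-(1-x)\ln(1-x)$ and $H_2(X)=\sum_{i,j}H(x_{ij})$ (a strictly concave function), $\widetilde{\mathbf p}=(\widetilde p_{ij})$ is the unique maximizer of $H_2$ on $\mathbb P^{D_1,D_2}$. $\widetilde{\mathcal G}(D_1,D_2)$ is the random bipartite graph with independent edges, the edge between vertex $i$ of set 1 and vertex $j$ of set 2 being present with probability $\widetilde p_{ij}$ (and no edges inside set 1 or inside set 2). Ordered trees: $\mathbb T^k$ is the set of (labeled) trees on vertex set $[k]$, $\mathbb S_n^k$ the set of injective maps $s:[k]\to[n]$. $\mathcal T_{\mathbf b}(k,n)$ is the set of $(s,T)\in\mathbb S_n^k\times\mathbb T^k$ such that the image tree $s(T)$ has no edge with both ends in set 1 or both ends in set 2. With $b_u$ the degree of $u$ in $T$, $\psi(s,T,D)=\prod_{u\in[k]}d_{s(u)}^{\,b_u-1}$. For a graph $G$ on $[n]$, $\mathbf 1_s(T,G)=1$ if $\langle s(u_1),s(u_2)\rangle$ is an edge of $G$ for every edge $\langle u_1,u_2\rangle$ of $T$, and $0$ otherwise. $\mathbf p_{\mathbf b}(s,T)=E[\mathbf 1_s(T,\mathcal G_{\mathbf b}(D_1,D_2))]$ and $\widetilde{\mathbf p}(s,T)=E[\mathbf 1_s(T,\widetilde{\mathcal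 G}(D_1,D_2))]$. *)

theory Defs
  imports "HOL-Probability.Probability"
begin

text \<open>
  A graph on a vertex set of natural numbers is represented by its set of edges, an edge being
  a two-element set of vertices. For the bipartite graphs, \<open>[n] = {1..n1 + n2}\<close>, vertex \<open>i\<close> of
  set 1 is \<open>i\<close> and vertex \<open>j\<close> of set 2 is \<open>n1 + j\<close>. The values of the vectors \<open>D1\<close> and \<open>D2\<close>
  outside \<open>{1..n1}\<close> and \<open>{1..n2}\<close> are never used.
\<close>

definition simple_graph :: "nat set \<Rightarrow> nat set set \<Rightarrow> bool" where
  "simple_graph V E \<longleftrightarrow> E \<subseteq> {{u, v} | u v. u \<in> V \<and> v \<in> V \<and> u \<noteq> v}"

definition vertex_degree :: "nat set set \<Rightarrow> nat \<Rightarrow> nat" where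
  "vertex_degree E v = card {e \<in> E. v \<in> e}"

definition graph_connected :: "nat set \<Rightarrow> nat set set \<Rightarrow> bool" where
  "graph_connected V E \<longleftrightarrow> (\<forall>u\<in>V. \<forall>v\<in>V. (u, v) \<in> {(a, b). {a, b} \<in> E}\<^sup>*)"

definition is_cycle :: "nat set set \<Rightarrow> nat list \<Rightarrow> bool" where
  "is_cycle E c \<longleftrightarrow> length c \<ge> 3 \<and> distinct c \<and>
     (\<forall>i<length c. {c ! i, c ! (Suc i mod length c)} \<in> E)"

definition labeled_trees :: "nat \<Rightarrow> nat set set set" where
  "labeled_trees k =
     {T. simple_graph {1..k} T \<and> graph_connected {1..k} T \<and> (\<nexists>c. is_cycle T c)}"


definition bip_set1 :: "nat \<Rightarrow> nat set" where
  "bip_set1 n1 = {1..n1}"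

definition bip_set2 :: "nat \<Rightarrow> nat \<Rightarrow> nat set" where
  "bip_set2 n1 n2 = {n1 + 1..n1 + n2}"

definition no_inner_edge :: "nat \<Rightarrow> nat \<Rightarrow> nat set set \<Rightarrow> bool" where
  "no_inner_edge n1 n2 E \<longleftrightarrow> (\<forall>e\<in>E. \<not> e \<subseteq> bip_set1 n1 \<and> \<not> e \<subseteq> bip_set2 n1 n2)"

definition combined_degrees :: "nat \<Rightarrow> (nat \<Rightarrow> nat) \<Rightarrow> (nat \<Rightarrow> nat) \<Rightarrow> nat \<Rightarrow> nat" where
  "combined_degrees n1 D1 D2 v = (if v \<le> n1 then D1 v else D2 (v - n1))"

definition bip_graphs :: "nat \<Rightarrow> nat \<Rightarrow> (nat \<Rightarrow> nat) \<Rightarrow> (nat \<Rightarrow> nat) \<Rightarrow> nat set set set" where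
  "bip_graphs n1 n2 D1 D2 =
     {G. simple_graph {1..n1 + n2} G \<and> no_inner_edge n1 n2 G \<and>
         (\<forall>i\<in>{1..n1}. vertex_degree G i = D1 i) \<and>
         (\<forall>j\<in>{1..n2}. vertex_degree G (n1 + j) = D2 j)}"

definition uniform_bip_graph ::
    "nat \<Rightarrow> nat \<Rightarrow> (nat \<Rightarrow> nat) \<Rightarrow> (nat \<Rightarrow> nat) \<Rightarrow> nat set set pmf" where
  "uniform_bip_graph n1 n2 D1 D2 = pmf_of_set (bip_graphs n1 n2 D1 D2)"


text \<open>
  A matrix is a function on index pairs which is extensional on \<open>{1..n1} \<times> {1..n2}\<close>, so that
  matrices with the same entries are equal.
\<close>

definition bip_polytope ::
    "nat \<Rightarrow> nat \<Rightarrow> (nat \<Rightarrow> nat) \<Rightarrow> (nat \<Rightarrow> nat) \<Rightarrow> (nat \<times> nat \<Rightarrow> real) set" where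
  "bip_polytope n1 n2 D1 D2 =
     {X \<in> {1..n1} \<times> {1..n2} \<rightarrow>\<^sub>E {0..1}.
        (\<forall>i\<in>{1..n1}. (\<Sum>j\<in>{1..n2}. X (i, j)) = real (D1 i)) \<and>
        (\<forall>j\<in>{1..n2}. (\<Sum>i\<in>{1..n1}. X (i, j)) = real (D2 j))}"

definition nonempty_interior ::
    "nat \<Rightarrow> nat \<Rightarrow> (nat \<Rightarrow> nat) \<Rightarrow> (nat \<Rightarrow> nat) \<Rightarrow> bool" where
  "nonempty_interior n1 n2 D1 D2 \<longleftrightarrow>
     (\<exists>X\<in>bip_polytope n1 n2 D1 D2. \<forall>i\<in>{1..n1}. \<forall>j\<in>{1..n2}. 0 < X (i, j) \<and> X (i, j) < 1)"

text \<open>At \<open>x = 0\<close> and \<open>x = 1\<close> the convention \<open>ln 0 = 0\<close> gives the usual value \<open>0\<close>.\<close>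

definition entropy_fun :: "real \<Rightarrow> real" where
  "entropy_fun x = - x * ln x - (1 - x) * ln (1 - x)"

definition matrix_entropy :: "nat \<Rightarrow> nat \<Rightarrow> (nat \<times> nat \<Rightarrow> real) \<Rightarrow> real" where
  "matrix_entropy n1 n2 X = (\<Sum>i\<in>{1..n1}. \<Sum>j\<in>{1..n2}. entropy_fun (X (i, j)))"

definition max_entropy_matrix ::
    "nat \<Rightarrow> nat \<Rightarrow> (nat \<Rightarrow> nat) \<Rightarrow> (nat \<Rightarrow> nat) \<Rightarrow> nat \<times> nat \<Rightarrow> real" where
  "max_entropy_matrix n1 n2 D1 D2 =
     (THE X. is_arg_max (matrix_entropy n1 n2) (\<lambda>Y. Y \<in> bip_polytope n1 n2 D1 D2) X)"

definition independent_bip_graph ::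
    "nat \<Rightarrow> nat \<Rightarrow> (nat \<Rightarrow> nat) \<Rightarrow> (nat \<Rightarrow> nat) \<Rightarrow> nat set set pmf" where
  "independent_bip_graph n1 n2 D1 D2 =
     map_pmf (\<lambda>present. {{i, n1 + j} | i j. i \<in> {1..n1} \<and> j \<in> {1..n2} \<and> present (i, j)})
       (Pi_pmf ({1..n1} \<times> {1..n2}) False
          (\<lambda>(i, j). bernoulli_pmf (max_entropy_matrix n1 n2 D1 D2 (i, j))))"


text \<open>Extensionality of the maps makes the set of ordered trees finite.\<close>

definition injective_maps :: "nat \<Rightarrow> nat \<Rightarrow> (nat \<Rightarrow> nat) set" where
  "injective_maps k n = {s \<in> {1..k} \<rightarrow>\<^sub>E {1..n}. inj_on s {1..k}}"

definition bip_ordered_trees ::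
    "nat \<Rightarrow> nat \<Rightarrow> nat \<Rightarrow> ((nat \<Rightarrow> nat) \<times> nat set set) set" where
  "bip_ordered_trees k n1 n2 =
     {(s, T). s \<in> injective_maps k (n1 + n2) \<and> T \<in> labeled_trees k \<and>
              no_inner_edge n1 n2 ((\<lambda>e. s ` e) ` T)}"

text \<open>The exponent is an integer since it equals \<open>-1\<close> when \<open>k = 1\<close>.\<close>

definition tree_weight ::
    "nat \<Rightarrow> (nat \<Rightarrow> nat) \<Rightarrow> nat set set \<Rightarrow> (nat \<Rightarrow> nat) \<Rightarrow> real" where
  "tree_weight k s T d = (\<Prod>u\<in>{1..k}. real (d (s u)) powi (int (vertex_degree T u) - 1))"

definition tree_indicator :: "(nat \<Rightarrow> nat) \<Rightarrow> nat set set \<Rightarrow> nat set set \<Rightarrow> real" where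
  "tree_indicator s T G = (if \<forall>u1 u2. {u1, u2} \<in> T \<longrightarrow> {s u1, s u2} \<in> G then 1 else 0)"

definition uniform_tree_prob ::
    "nat \<Rightarrow> nat \<Rightarrow> (nat \<Rightarrow> nat) \<Rightarrow> (nat \<Rightarrow> nat) \<Rightarrow> (nat \<Rightarrow> nat) \<Rightarrow> nat set set \<Rightarrow> real" where
  "uniform_tree_prob n1 n2 D1 D2 s T =
     measure_pmf.expectation (uniform_bip_graph n1 n2 D1 D2) (tree_indicator s T)"

definition independent_tree_prob ::
    "nat \<Rightarrow> nat \<Rightarrow> (nat \<Rightarrow> nat) \<Rightarrow> (nat \<Rightarrow> nat) \<Rightarrow> (nat \<Rightarrow> nat) \<Rightarrow> nat set set \<Rightarrow> real" where
  "independent_tree_prob n1 n2 D1 D2 s T =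
     measure_pmf.expectation (independent_bip_graph n1 n2 D1 D2) (tree_indicator s T)"

definition total_degree :: "nat \<Rightarrow> nat \<Rightarrow> (nat \<Rightarrow> nat) \<Rightarrow> (nat \<Rightarrow> nat) \<Rightarrow> nat" where
  "total_degree n1 n2 D1 D2 = (\<Sum>v\<in>{1..n1 + n2}. combined_degrees n1 D1 D2 v)"

definition tree_discrepancy ::
    "nat \<Rightarrow> nat \<Rightarrow> nat \<Rightarrow> (nat \<Rightarrow> nat) \<Rightarrow> (nat \<Rightarrow> nat) \<Rightarrow> real" where
  "tree_discrepancy k n1 n2 D1 D2 =
     1 / real (total_degree n1 n2 D1 D2) *
     (\<Sum>(s, T)\<in>bip_ordered_trees k n1 n2.
        1 / tree_weight k s T (combined_degrees n1 D1 D2) *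
        \<bar>uniform_tree_prob n1 n2 D1 D2 s T - independent_tree_prob n1 n2 D1 D2 s T\<bar>)"

end

theory Submission
  imports Defs "HOL-Real_Asymp.Real_Asymp"
begin

text \<open>
  The uniform graph is the independent one conditioned on an event of probability at least
  \<open>n powr (- n)\<close>. Indeed every graph with the given degrees has probability at least
  \<open>exp (- H pm)\<close> under the product measure because \<open>pm\<close> maximises the entropy, and there are at
  least \<open>exp (H pm) / n ^ n\<close> of them: this is a capacity argument that fixes the vertex degrees
  one after the other, each at the cost of a factor \<open>n\<close>, since the generating polynomial of
  the degree of one vertex has log-concave coefficients. Log-concavity comes from pairing up, in the
  symmetric difference of two graphs, the edges of the two graphs at every vertex where the degrees agree.

  By Jensen's inequality an expectation under the uniform measure is at most \<open>n * ln n\<close> plus the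
  logarithm of the exponential moment under the product measure, where the edges at the vertices
  of one side form independent families. A union bound over the at most \<open>n ^ k\<close> embeddings of a
  tree at each vertex costs another \<open>k * n * ln n\<close>. Replacing the edges of a tree by their
  probabilities one leaf at a time then gives the bound.
\<close>

section \<open>Balanced sign choices\<close>

text \<open>Two features shape the proof. The absolute values stand outside the expectation, and
  whether a partial tree is embedded depends on the same random graph as the next edge. The signs of
  the averages can be fixed as coefficients that do not see the graph; the weights of the partial
  embeddings do see it. But for every graph the weights of the embeddings with the parent at
  \<open>x\<close>, divided by the degree of \<open>x\<close>, sum to at most 1, so a weighted sum
  of deviations is at most their maximum, and only this maximum has to be controlled. A parent can
  lie on either side, while edge sets at different vertices are disjoint within one side only; hence
  each side is treated by itself. The exponential parameter \<open>sqrt (n * ln n / M)\<close> is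
  the source of the square root in the bound.

  In the count, log-concavity is needed while other degrees are already prescribed. The merging of
  edges that proves it creates parallel edges and loops, so it is carried out for abstract edges
  that carry an incidence vector.\<close>

definition net :: "('e \<Rightarrow> 'v \<Rightarrow> int) \<Rightarrow> 'e set \<Rightarrow> 'e set \<Rightarrow> 'v \<Rightarrow> int" where
  "net \<phi> I F v = (\<Sum>e\<in>I. if e \<in> F then \<phi> e v else - \<phi> e v)"

text \<open>\<open>F\<close> consists of the edges counted with sign +1. On \<open>P\<close> two
  graphs will have equal degrees; \<open>l\<close> is the vertex whose degree difference is
  tracked.\<close>

definition balanced :: "('e \<Rightarrow> 'v \<Rightarrow> int) \<Rightarrow> 'e set \<Rightarrow> 'v set \<Rightarrow> 'v \<Rightarrow> int \<Rightarrow> 'e set set" where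
  "balanced \<phi> I P l q = {F. F \<subseteq> I \<and> (\<forall>v\<in>P. net \<phi> I F v = 0) \<and> net \<phi> I F l = q}"

text \<open>The ends \<open>a\<close> and \<open>b\<close> may coincide: merging two parallel edges
  gives a loop, whose vector is 0.\<close>

definition edge_vec :: "('v \<Rightarrow> int) \<Rightarrow> bool" where
  "edge_vec f \<longleftrightarrow> (\<exists>a b. f = (\<lambda>v. of_bool (v = a) - of_bool (v = b)))"

lemma edge_vec_cases: "edge_vec f \<Longrightarrow> f v = 0 \<or> f v = 1 \<or> f v = -1"
  unfolding edge_vec_def of_bool_def by (elim exE) simp

text \<open>If signs \<open>x\<close> and \<open>y\<close> make the edges opposed at
  \<open>v\<close>, then \<open>y = - x * f v * g v\<close> because the values at \<open>v\<close>
  are units, so \<open>x * f + y * g\<close> is \<open>x\<close> times the vector of this lemma. The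
  merged edge joins the two remaining ends.\<close>

lemma edge_vec_merge:
  assumes "edge_vec f" "edge_vec g" "f v \<noteq> 0" "g v \<noteq> 0"
  shows "edge_vec (\<lambda>w. f w - f v * g v * g w)"
proof -
  obtain a b where f: "f = (\<lambda>v. of_bool (v = a) - of_bool (v = b))"
    using assms by (auto simp: edge_vec_def)
  obtain c d where g: "g = (\<lambda>v. of_bool (v = c) - of_bool (v = d))"
    using assms by (auto simp: edge_vec_def)
  have "(v = a \<and> v \<noteq> b \<or> v \<noteq> a \<and> v = b)" "(v = c \<and> v \<noteq> d \<or> v \<noteq> c \<and> v = d)"
    using assms f g by auto
  then consider "v = a" "v \<noteq> b" "v = c" "v \<noteq> d" | "v = a" "v \<noteq> b" "v \<noteq> c" "v = d"
    | "v \<noteq> a" "v = b" "v = c" "v \<noteq> d" | "v \<noteq> a" "v = b" "v \<noteq> c" "v = d"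
    by blast
  then show ?thesis
  proof cases
    case 1
    then have "(\<lambda>w. f w - f v * g v * g w) = (\<lambda>w. of_bool (w = d) - of_bool (w = b))"
      by (simp add: f g)
    then show ?thesis unfolding edge_vec_def by blast
  next
    case 2
    then have "(\<lambda>w. f w - f v * g v * g w) = (\<lambda>w. of_bool (w = c) - of_bool (w = b))"
      by (simp add: f g)
    then show ?thesis unfolding edge_vec_def by blast
  next
    case 3
    then have "(\<lambda>w. f w - f v * g v * g w) = (\<lambda>w. of_bool (w = a) - of_bool (w = d))"
      by (simp add: f g)
    then show ?thesis unfolding edge_vec_def by blast
  next
    case 4
    then have "(\<lambda>w. f w - f v * g v * g w) = (\<lambda>w. of_bool (w = a) - of_bool (w = c))"
      by (simp add: f g)
    then show ?thesis unfolding edge_vec_def by blast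
  qed
qed

lemma finite_balanced: "finite I \<Longrightarrow> finite (balanced \<phi> I P l q)"
  by (rule finite_subset[of _ "Pow I"]) (auto simp: balanced_def)

lemma net_compl: "net \<phi> I (I - F) v = - net \<phi> I F v"
  unfolding net_def sum_negf[symmetric] by (rule sum.cong) auto

text \<open>Complementing \<open>F\<close> reverses every sign, which keeps the zeros on
  \<open>P\<close> and negates the value at \<open>l\<close>.\<close>

lemma card_balanced_uminus:
  "card (balanced \<phi> I P l (- q)) = card (balanced \<phi> I P l q)"
proof (rule bij_betw_same_card)
  show "bij_betw (\<lambda>F. I - F) (balanced \<phi> I P l (-q)) (balanced \<phi> I P l q)"
    by (rule bij_betw_byWitness[where f' = "\<lambda>F. I - F"])
      (auto simp: balanced_def net_compl double_diff)
qed

lemma net_insert: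
  assumes "finite I" "e \<in> I"
  shows "net \<phi> I F v = (if e \<in> F then \<phi> e v else - \<phi> e v) + net \<phi> (I - {e}) (F - {e}) v"
  unfolding net_def by (subst sum.remove[OF assms]) (auto intro!: sum.cong)

lemma card_balanced_remove:
  assumes "finite I" "e \<in> I" "\<And>v. v \<in> P \<Longrightarrow> \<phi> e v = 0"
  shows "card (balanced \<phi> I P l q) =
    card (balanced \<phi> (I - {e}) P l (q - \<phi> e l)) + card (balanced \<phi> (I - {e}) P l (q + \<phi> e l))"
proof -
  let ?A = "{F \<in> balanced \<phi> I P l q. e \<in> F}" and ?B = "{F \<in> balanced \<phi> I P l q. e \<notin> F}"
  have "balanced \<phi> I P l q = ?A \<union> ?B" by auto
  then have "card (balanced \<phi> I P l q) = card ?A + card ?B"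
    using finite_balanced[OF assms(1)] by (metis (no_types, lifting) card_Un_disjoint disjoint_iff
      finite_Un mem_Collect_eq)
  moreover have "card ?A = card (balanced \<phi> (I - {e}) P l (q - \<phi> e l))"
  proof (rule bij_betw_same_card, rule bij_betw_byWitness[where f = "\<lambda>F. F - {e}" and f' = "insert e"])
    show "(\<lambda>F. F - {e}) ` ?A \<subseteq> balanced \<phi> (I - {e}) P l (q - \<phi> e l)"
      using assms by (auto simp: balanced_def net_insert[OF assms(1,2)])
    show "insert e ` balanced \<phi> (I - {e}) P l (q - \<phi> e l) \<subseteq> ?A"
      using assms by (auto simp: balanced_def net_insert[OF assms(1,2)] subset_Diff_insert)
  qed (auto simp: balanced_def)
  moreover have "card ?B = card (balanced \<phi> (I - {e}) P l (q + \<phi> e l))"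
  proof (rule arg_cong[where f = card])
    have "net \<phi> I F v = - \<phi> e v + net \<phi> (I - {e}) F v" if "e \<notin> F" for F v
      using net_insert[OF assms(1,2), of \<phi> F v] that by simp
    then show "?B = balanced \<phi> (I - {e}) P l (q + \<phi> e l)"
      using assms by (auto simp: balanced_def subset_Diff_insert)
  qed
  ultimately show ?thesis by simp
qed

text \<open>Opposition at \<open>v\<close> makes the sign of \<open>e\<close> a function of the sign
  of \<open>e0\<close>, so \<open>e\<close> can be deleted once its vector is absorbed into that of
  \<open>e0\<close>.\<close>

lemma card_balanced_merge:
  fixes \<phi> :: "'e \<Rightarrow> 'v \<Rightarrow> int"
  assumes "finite I" "e0 \<in> I" "e \<in> I" "e \<noteq> e0" "v \<in> P"
    and unit: "\<phi> e0 v \<in> {1, -1}" "\<phi> e v \<in> {1, -1}"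
  defines "\<phi>' \<equiv> \<phi>(e0 := (\<lambda>w. \<phi> e0 w - \<phi> e0 v * \<phi> e v * \<phi> e w))"
  shows "card {F \<in> balanced \<phi> I P l q. (if e \<in> F then \<phi> e v else - \<phi> e v) =
             - (if e0 \<in> F then \<phi> e0 v else - \<phi> e0 v)} =
         card (balanced \<phi>' (I - {e}) P l q)"
proof -
  define opp where "opp F \<longleftrightarrow> (if e \<in> F then \<phi> e v else - \<phi> e v) =
             - (if e0 \<in> F then \<phi> e0 v else - \<phi> e0 v)" for F
  define h where "h G = (if opp (insert e G) then insert e G else G)" for G
  have net: "net \<phi>' (I - {e}) (F - {e}) w = net \<phi> I F w" if "opp F" for F w
  proof -
    have e0: "e0 \<in> I - {e}" "finite (I - {e})" using assms by auto
    have "net \<phi>' (I - {e}) (F - {e}) w = (if e0 \<in> F then \<phi>' e0 w else - \<phi>' e0 w)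
        + net \<phi>' (I - {e} - {e0}) (F - {e} - {e0}) w"
      using net_insert[OF e0(2,1), of \<phi>' "F - {e}" w] assms(4) by simp
    moreover have "net \<phi>' (I - {e} - {e0}) (F - {e} - {e0}) w = net \<phi> (I - {e} - {e0}) (F - {e} - {e0}) w"
      unfolding net_def by (rule sum.cong) (auto simp: \<phi>'_def)
    moreover have "net \<phi> I F w = (if e \<in> F then \<phi> e w else - \<phi> e w) +
        ((if e0 \<in> F then \<phi> e0 w else - \<phi> e0 w) + net \<phi> (I - {e} - {e0}) (F - {e} - {e0}) w)"
      using net_insert[OF assms(1,3), of \<phi> F w] net_insert[OF e0(2,1), of \<phi> "F - {e}" w] assms(4) by simp
    moreover have "(if e0 \<in> F then \<phi>' e0 w else - \<phi>' e0 w) =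
        (if e \<in> F then \<phi> e w else - \<phi> e w) + (if e0 \<in> F then \<phi> e0 w else - \<phi> e0 w)"
      using that unit unfolding opp_def by (cases "e \<in> F"; cases "e0 \<in> F") (auto simp: \<phi>'_def)
    ultimately show ?thesis by simp
  qed
  have h: "opp (h G) \<and> h G - {e} = G" if "e \<notin> G" for G
    using that unit assms(4) unfolding h_def opp_def by (cases "e0 \<in> G") auto
  have h': "h (F - {e}) = F" if "opp F" for F
    using that unit assms(4) unfolding h_def opp_def by (cases "e \<in> F") (auto simp: insert_absorb)
  have "bij_betw (\<lambda>F. F - {e}) {F \<in> balanced \<phi> I P l q. opp F} (balanced \<phi>' (I - {e}) P l q)"
  proof (rule bij_betw_byWitness[where f' = h])
    show "\<forall>F\<in>{F \<in> balanced \<phi> I P l q. opp F}. h (F - {e}) = F" using h' by auto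
    show "\<forall>F\<in>balanced \<phi>' (I - {e}) P l q. h F - {e} = F" using h by (auto simp: balanced_def)
    show "(\<lambda>F. F - {e}) ` {F \<in> balanced \<phi> I P l q. opp F} \<subseteq> balanced \<phi>' (I - {e}) P l q"
      by (auto simp: balanced_def net)
    show "h ` balanced \<phi>' (I - {e}) P l q \<subseteq> {F \<in> balanced \<phi> I P l q. opp F}"
    proof
      fix F assume "F \<in> h ` balanced \<phi>' (I - {e}) P l q"
      then obtain G where G: "G \<in> balanced \<phi>' (I - {e}) P l q" "F = h G" by auto
      then have "e \<notin> G" "G \<subseteq> I" by (auto simp: balanced_def)
      then have *: "opp (h G)" "h G - {e} = G" "h G \<subseteq> I" using h assms(3) by (auto simp: h_def)
      have "net \<phi> I (h G) w = net \<phi>' (I - {e}) G w" for w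
        using net[OF *(1), of w] *(2) by simp
      then show "F \<in> {F \<in> balanced \<phi> I P l q. opp F}"
        using G * by (auto simp: balanced_def)
    qed
  qed
  from bij_betw_same_card[OF this] show ?thesis unfolding opp_def .
qed

lemma sum_units_zero:
  fixes f :: "'e \<Rightarrow> int"
  assumes "finite X" "\<And>e. e \<in> X \<Longrightarrow> f e \<in> {1, -1}" "(\<Sum>e\<in>X. f e) = 0" "c \<in> {1, -1}"
  shows "2 * card {e \<in> X. f e = c} = card X"
proof -
  \<comment> \<open>The summand is 2 where the units \<open>c\<close> and \<open>f e\<close> agree
    and 0 elsewhere.\<close>
  have "(\<Sum>e\<in>X. 1 + c * f e) = (\<Sum>e\<in>X. if f e = c then 2 else 0)"
    by (intro sum.cong refl) (use assms(2,4) in fastforce)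
  moreover have "(\<Sum>e\<in>X. if f e = c then 2 else 0) = 2 * int (card {e \<in> X. f e = c})"
    using assms(1) by (subst sum.inter_filter[symmetric]) auto
  moreover have "(\<Sum>e\<in>X. 1 + c * f e) = int (card X)"
    using assms(3) by (simp add: sum.distrib sum_distrib_left[symmetric])
  ultimately show ?thesis by linarith
qed

text \<open>At a balanced vertex \<open>v\<close> the edge \<open>e0\<close> is opposed to exactly half of the edges at \<open>v\<close>, and merging
  it with any one of them gives a smaller instance.\<close>

lemma card_balanced_pairing:
  fixes \<phi> :: "'e \<Rightarrow> 'v \<Rightarrow> int"
  assumes "finite I" "e0 \<in> I" "v \<in> P" "\<phi> e0 v \<noteq> 0" "\<And>e. e \<in> I \<Longrightarrow> edge_vec (\<phi> e)"
  shows "card {e \<in> I. \<phi> e v \<noteq> 0} * card (balanced \<phi> I P l q) =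
    2 * (\<Sum>e\<in>{e \<in> I. \<phi> e v \<noteq> 0} - {e0}.
      card (balanced (\<phi>(e0 := (\<lambda>w. \<phi> e0 w - \<phi> e0 v * \<phi> e v * \<phi> e w))) (I - {e}) P l q))"
proof -
  let ?X = "{e \<in> I. \<phi> e v \<noteq> 0}" and ?B = "balanced \<phi> I P l q"
  let ?sg = "\<lambda>F e. if e \<in> F then \<phi> e v else - \<phi> e v"
  have fin: "finite ?X" "finite ?B" using assms finite_balanced by auto
  have unit: "\<phi> e v \<in> {1, -1}" if "e \<in> ?X" for e
    using that assms edge_vec_cases[of "\<phi> e" v] by auto
  have e0: "e0 \<in> ?X" using assms by auto
  have half: "2 * card {e \<in> ?X - {e0}. ?sg F e = - ?sg F e0} = card ?X" if "F \<in> ?B" for F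
  proof -
    have "(\<Sum>e\<in>?X. ?sg F e) = net \<phi> I F v"
      unfolding net_def by (rule sum.mono_neutral_left) (use assms in auto)
    then have "(\<Sum>e\<in>?X. ?sg F e) = 0" using that assms by (auto simp: balanced_def)
    then have "2 * card {e \<in> ?X. ?sg F e = - ?sg F e0} = card ?X"
      by (intro sum_units_zero) (use fin unit unit[OF e0] in auto)
    moreover have "{e \<in> ?X. ?sg F e = - ?sg F e0} = {e \<in> ?X - {e0}. ?sg F e = - ?sg F e0}"
      using unit[OF e0] by auto
    ultimately show ?thesis by simp
  qed
  \<comment> \<open>Double counting of the pairs of a balanced \<open>F\<close> and an edge opposed
    to \<open>e0\<close> in it. The factor \<open>card ?X\<close> does not depend on
    \<open>q\<close>, so the identity can be compared for different \<open>q\<close>.\<close>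
  have "card ?X * card ?B = (\<Sum>F\<in>?B. 2 * card {e \<in> ?X - {e0}. ?sg F e = - ?sg F e0})"
    using half by simp
  also have "\<dots> = 2 * (\<Sum>F\<in>?B. \<Sum>e\<in>?X - {e0}. if ?sg F e = - ?sg F e0 then 1 else 0)"
    using fin by (simp add: sum_distrib_left sum.inter_filter[symmetric] del: sum.inter_filter)
  also have "(\<Sum>F\<in>?B. \<Sum>e\<in>?X - {e0}. if ?sg F e = - ?sg F e0 then 1 else 0) =
     (\<Sum>e\<in>?X - {e0}. \<Sum>F\<in>?B. if ?sg F e = - ?sg F e0 then 1 else (0::nat))"
    by (rule sum.swap)
  also have "\<dots> = (\<Sum>e\<in>?X - {e0}. card {F \<in> ?B. ?sg F e = - ?sg F e0})"
    using fin by (simp add: sum.inter_filter[symmetric] del: sum.inter_filter)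
  also have "\<dots> = (\<Sum>e\<in>?X - {e0}.
      card (balanced (\<phi>(e0 := (\<lambda>w. \<phi> e0 w - \<phi> e0 v * \<phi> e v * \<phi> e w))) (I - {e}) P l q))"
    by (intro sum.cong refl card_balanced_merge) (use assms unit e0 in auto)
  finally show ?thesis .
qed

text \<open>As long as some edge meets \<open>P\<close>, the pairing identity carries the inequality
  over from smaller edge sets. When none does, restoring an edge is one step of a symmetric walk at
  \<open>l\<close>, which preserves symmetry and unimodality. The step is 2 because reversing an
  edge changes a net value by 0 or 2 in absolute value.\<close>

lemma card_balanced_unimodal:
  fixes \<phi> :: "'e \<Rightarrow> 'v \<Rightarrow> int"
  assumes "finite I" "\<And>e. e \<in> I \<Longrightarrow> edge_vec (\<phi> e)" "q \<ge> 0"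
  shows "card (balanced \<phi> I P l (q + 2)) \<le> card (balanced \<phi> I P l q)"
  using assms
proof (induction "card I" arbitrary: I \<phi> q rule: less_induct)
  case less
  show ?case
  proof (cases "\<exists>e\<in>I. \<exists>v\<in>P. \<phi> e v \<noteq> 0")
    case True
    then obtain e0 v where e0: "e0 \<in> I" "v \<in> P" "\<phi> e0 v \<noteq> 0" by auto
    let ?X = "{e \<in> I. \<phi> e v \<noteq> 0}"
    let ?\<psi> = "\<lambda>e. \<phi>(e0 := (\<lambda>w. \<phi> e0 w - \<phi> e0 v * \<phi> e v * \<phi> e w))"
    have "card (balanced (?\<psi> e) (I - {e}) P l (q + 2)) \<le> card (balanced (?\<psi> e) (I - {e}) P l q)"
      if e: "e \<in> ?X - {e0}" for e
    proof (rule less.hyps)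
      show "card (I - {e}) < card I" using e less.prems by (intro card_Diff1_less) auto
      show "edge_vec (?\<psi> e e')" if "e' \<in> I - {e}" for e'
        using that e e0 less.prems by (auto intro: edge_vec_merge)
    qed (use less.prems in auto)
    then have "2 * (\<Sum>e\<in>?X - {e0}. card (balanced (?\<psi> e) (I - {e}) P l (q + 2)))
        \<le> 2 * (\<Sum>e\<in>?X - {e0}. card (balanced (?\<psi> e) (I - {e}) P l q))"
      by (intro mult_left_mono sum_mono) auto
    then have "card ?X * card (balanced \<phi> I P l (q + 2)) \<le> card ?X * card (balanced \<phi> I P l q)"
      by (simp only: card_balanced_pairing[where \<phi> = \<phi>, OF less.prems(1) e0 less.prems(2)])
    moreover have "card ?X > 0" using e0 less.prems by (auto simp: card_gt_0_iff)
    ultimately show ?thesis by simp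
  next
    case False
    show ?thesis
    proof (cases "I = {}")
      case True
      then show ?thesis using less.prems by (auto simp: balanced_def net_def)
    next
      case ne: False
      then obtain e where e: "e \<in> I" by auto
      have lt: "card (I - {e}) < card I" using e less.prems by (intro card_Diff1_less) auto
      let ?c = "\<lambda>q. card (balanced \<phi> (I - {e}) P l q)"
      have IH: "?c (r + 2) \<le> ?c r" if "r \<ge> 0" for r
        using less.hyps[OF lt, of \<phi> r] less.prems that by auto
      have rem: "card (balanced \<phi> I P l r) = ?c (r - \<phi> e l) + ?c (r + \<phi> e l)" for r
        using False e less.prems by (intro card_balanced_remove) auto
      \<comment> \<open>For \<open>q = 0\<close> the argument \<open>q - 1\<close> is negative and
        out of reach of the induction hypothesis; symmetry gives equality there.\<close>
      have "?c (q + 1) \<le> ?c (q - 1)"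
      proof (cases "q = 0")
        case True
        then show ?thesis using card_balanced_uminus[of \<phi> "I - {e}" P l 1] by simp
      next
        case False
        then show ?thesis using IH[of "q - 1"] less.prems by (simp add: algebra_simps)
      qed
      moreover have "?c (q + 3) \<le> ?c (q + 1)" using IH[of "q + 1"] less.prems by (simp add: algebra_simps)
      moreover have "?c (q + 2) \<le> ?c q" using IH[of q] less.prems by simp
      ultimately show ?thesis
        using edge_vec_cases[OF less.prems(2)[OF e], of l] by (auto simp: rem algebra_simps)
    qed
  qed
qed

section \<open>Counting bipartite graphs with given degrees\<close>

lemma vertex_degree_disjoint_Un:
  "finite A \<Longrightarrow> finite B \<Longrightarrow> A \<inter> B = {} \<Longrightarrow>
    vertex_degree (A \<union> B) v = vertex_degree A v + vertex_degree B v"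
  unfolding vertex_degree_def by (subst card_Un_disjoint[symmetric]) (auto intro!: arg_cong[where f = card])

text \<open>By \<open>bound\<close>, \<open>K\<close> is at most the capacity, the infimum over
  \<open>t\<close> of the polynomial divided by \<open>t ^ d\<close>. At a \<open>t\<close> where
  term \<open>d\<close> is the largest, each of the \<open>N\<close> terms is at most
  \<open>a d * t ^ d\<close>. Log-concavity supplies such a \<open>t\<close>; it is assumed for all
  \<open>j + 2 \<le> k\<close> so that the support has no gaps.\<close>

lemma log_concave_coeff_bound:
  fixes a :: "nat \<Rightarrow> real"
  assumes nonneg: "\<And>j. a j \<ge> 0" and K: "K > 0"
    and lc: "\<And>j k. j + 2 \<le> k \<Longrightarrow> a j * a k \<le> a (j + 1) * a (k - 1)"
    and bound: "\<And>t. t > 0 \<Longrightarrow> K \<le> (\<Sum>j<N. a j * t ^ j) / t ^ d"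
  shows "K \<le> real N * a d"
proof (cases "a d = 0")
  \<comment> \<open>Without gaps the support lies strictly on one side of \<open>d\<close>, and then
    a small or a large \<open>t\<close> violates \<open>bound\<close>.\<close>
  case True
  have conn: "a m > 0" if "a j > 0" "a k > 0" "j \<le> m" "m \<le> k" for j k m
    using that
  proof (induction "k - j" arbitrary: j k rule: less_induct)
    case less
    show ?case
    proof (cases "m = j \<or> m = k")
      case False
      then have jk: "j + 2 \<le> k" "j + 1 \<le> m" "m \<le> k - 1" using less.prems by auto
      have "0 < a (j + 1) * a (k - 1)" using lc[OF jk(1)] less.prems(1,2) by (meson less_le_trans mult_pos_pos)
      then have "a (j + 1) > 0" "a (k - 1) > 0"
        using nonneg[of "j + 1"] nonneg[of "k - 1"] by (auto simp: zero_less_mult_iff)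
      then show ?thesis using less.hyps[of "k - 1" "j + 1"] jk by auto
    qed (use less.prems in auto)
  qed
  define S where "S = (\<Sum>j<N. a j)"
  have S: "S \<ge> 0" unfolding S_def using nonneg by (simp add: sum_nonneg)
  have False if *: "\<And>j. a j > 0 \<Longrightarrow> j > d"
  proof -
    define t where "t = min 1 (K / (S + 1))"
    have t: "t > 0" "t \<le> 1" using K S by (auto simp: t_def)
    have "(\<Sum>j<N. a j * t ^ j) / t ^ d \<le> (\<Sum>j<N. a j * t)"
      unfolding sum_divide_distrib
    proof (rule sum_mono)
      fix j assume "j \<in> {..<N}"
      show "a j * t ^ j / t ^ d \<le> a j * t"
      proof (cases "a j > 0")
        case True
        then have "d < j" using * by auto
        then have "t ^ j = t ^ d * (t * t ^ (j - Suc d))" by (simp flip: power_Suc power_add)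
        moreover have "t ^ (j - Suc d) \<le> 1" using t by (simp add: power_le_one)
        ultimately show ?thesis using t True by (simp add: mult_left_le)
      next
        case False
        then show ?thesis using nonneg[of j] by simp
      qed
    qed
    also have "\<dots> = S * t" by (simp add: S_def sum_distrib_right)
    also have "\<dots> \<le> S * (K / (S + 1))" using S by (intro mult_left_mono) (auto simp: t_def)
    also have "\<dots> < K" using S K by (simp add: field_simps)
    finally show False using bound[OF t(1)] by simp
  qed
  moreover have False if *: "\<And>j. a j > 0 \<Longrightarrow> j < d"
  proof -
    define t where "t = max 1 ((S + 1) / K)"
    have t: "t > 0" "t \<ge> 1" using K S by (auto simp: t_def)
    have "(\<Sum>j<N. a j * t ^ j) / t ^ d \<le> (\<Sum>j<N. a j / t)"
      unfolding sum_divide_distrib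
    proof (rule sum_mono)
      fix j assume "j \<in> {..<N}"
      show "a j * t ^ j / t ^ d \<le> a j / t"
      proof (cases "a j > 0")
        case True
        then have "j < d" using * by auto
        then have "t ^ d = t ^ j * (t * t ^ (d - Suc j))" by (simp flip: power_Suc power_add)
        moreover have "t ^ (d - Suc j) \<ge> 1" using t by simp
        ultimately show ?thesis using t True by (simp add: field_simps)
      next
        case False
        then show ?thesis using nonneg[of j] by simp
      qed
    qed
    also have "\<dots> = S / t" by (simp add: S_def sum_divide_distrib)
    also have "\<dots> < K"
    proof -
      have "S < (S + 1) / K * K" using K by simp
      also have "\<dots> \<le> t * K" using K by (intro mult_right_mono) (auto simp: t_def)
      finally show ?thesis using t by (simp add: field_simps)
    qed
    finally show False using bound[OF t(1)] by simp
  qed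
  moreover have "(\<forall>j. a j > 0 \<longrightarrow> j > d) \<or> (\<forall>j. a j > 0 \<longrightarrow> j < d)"
  proof (rule ccontr)
    assume "\<not> ?thesis"
    then obtain j k where "a j > 0" "j \<le> d" "a k > 0" "d \<le> k" by (auto simp: not_less)
    then show False using conn[of j k d] True by simp
  qed
  ultimately show ?thesis by blast
next
  case False
  then have ad: "a d > 0" using nonneg[of d] by simp
  \<comment> \<open>\<open>t\<close> has to lie between the ratios \<open>a (d - 1) / a d\<close>
    and \<open>a d / a (d + 1)\<close>, which log-concavity puts in this order. The upper one is
    taken if it is finite, else the lower one if it is positive; otherwise \<open>a d\<close> is the
    only positive coefficient and any \<open>t\<close> serves.\<close>
  define t where "t = (if a (d + 1) > 0 then a d / a (d + 1)
      else if d \<ge> 1 \<and> a (d - 1) > 0 then a (d - 1) / a d else 1)"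
  have t: "t > 0" using ad by (auto simp: t_def)
  have up1: "a (d + 1) * t \<le> a d" using ad nonneg[of "d + 1"] by (auto simp: t_def)
  have down1: "a (d - 1) \<le> a d * t" if "d \<ge> 1"
    using that lc[of "d - 1" "d + 1"] ad nonneg[of "d - 1"] nonneg[of "d + 1"]
    by (auto simp: t_def field_simps)
  have up: "a (d + i) * t ^ i \<le> a d" for i
  proof (induction i)
    case (Suc i)
    have "a d * a (d + Suc i) \<le> a (d + 1) * a (d + i)"
      using lc[of d "d + Suc i"] by (cases i) auto
    then have "a d * (a (d + Suc i) * t ^ Suc i) \<le> (a (d + 1) * t) * (a (d + i) * t ^ i)"
      using t mult_right_mono[of "a d * a (d + Suc i)" "a (d + 1) * a (d + i)" "t ^ Suc i"]
      by (simp add: algebra_simps)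
    also have "\<dots> \<le> a d * a d" using Suc up1 t nonneg ad by (intro mult_mono) auto
    finally show ?case using ad by simp
  qed simp
  have down: "i \<le> d \<Longrightarrow> a (d - i) \<le> a d * t ^ i" for i
  proof (induction i)
    case (Suc i)
    have "a (d - Suc i) * a d \<le> a (d - i) * a (d - 1)"
      using lc[of "d - Suc i" d] Suc.prems by (cases i) (auto simp: Suc_diff_Suc algebra_simps)
    also have "\<dots> \<le> (a d * t ^ i) * (a d * t)"
      using Suc down1 t nonneg ad by (intro mult_mono) auto
    finally show ?case using ad by (simp add: algebra_simps)
  qed simp
  have "(\<Sum>j<N. a j * t ^ j) / t ^ d \<le> (\<Sum>j<N. a d)"
    unfolding sum_divide_distrib
  proof (rule sum_mono)
    fix j assume "j \<in> {..<N}"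
    show "a j * t ^ j / t ^ d \<le> a d"
    proof (cases "j \<le> d")
      case True
      then have "a j * t ^ j \<le> a d * t ^ (d - j) * t ^ j" using down[of "d - j"] t by (intro mult_right_mono) auto
      also have "\<dots> = a d * t ^ d" using True by (simp flip: power_add)
      finally show ?thesis using t by (simp add: field_simps)
    next
      case False
      then have "t ^ j = t ^ d * t ^ (j - d)" by (simp flip: power_add)
      then show ?thesis using up[of "j - d"] t False by simp
    qed
  qed
  then show ?thesis using bound[OF t] by simp
qed

section \<open>Inequalities for the binary entropy\<close>

lemma mult_ln_diff_le:
  fixes a b :: real
  assumes "a \<ge> 0" "b > 0"
  shows "a * ln b - a * ln a \<le> b - a"
proof (cases "a = 0")
  case False
  then have "a * ln (b / a) \<le> a * (b / a - 1)"
    using assms by (intro mult_left_mono ln_le_minus_one) auto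
  then show ?thesis using False assms by (simp add: ln_div algebra_simps)
qed (use assms in auto)

lemma entropy_fun_le_cross:
  assumes "0 \<le> a" "a \<le> 1" "0 < b" "b < 1"
  shows "entropy_fun a \<le> - a * ln b - (1 - a) * ln (1 - b)"
  using mult_ln_diff_le[of a b] mult_ln_diff_le[of "1 - a" "1 - b"] assms
  by (simp add: entropy_fun_def)

text \<open>Gibbs' inequality against the Bernoulli law with odds \<open>y\<close>. This is the
  duality between the entropy and \<open>ln (1 + y)\<close>, with equality at
  \<open>a = y / (1 + y)\<close>.\<close>

lemma entropy_fun_le_ln_add_one:
  assumes "0 \<le> a" "a \<le> 1" "0 < y"
  shows "entropy_fun a + a * ln y \<le> ln (1 + y)"
proof -
  have "1 - y / (1 + y) = 1 / (1 + y)" using assms by (simp add: field_simps)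
  then have "entropy_fun a \<le> - a * (ln y - ln (1 + y)) - (1 - a) * (- ln (1 + y))"
    using entropy_fun_le_cross[of a "y / (1 + y)"] assms by (simp add: ln_div)
  then show ?thesis by (simp add: algebra_simps)
qed

section \<open>Degrees in pairs of bipartite graphs\<close>

definition bip_edges :: "nat set \<Rightarrow> nat set \<Rightarrow> nat set set" where
  "bip_edges V1 V2 = {{x, y} | x y. x \<in> V1 \<and> y \<in> V2}"

locale bipartition =
  fixes V1 V2 :: "nat set"
  assumes finV: "finite V1" "finite V2" and disjV: "V1 \<inter> V2 = {}"
begin

abbreviation "V \<equiv> V1 \<union> V2"
abbreviation "EE \<equiv> bip_edges V1 V2"

lemma finite_EE: "finite EE"
proof -
  have "EE = (\<lambda>(x, y). {x, y}) ` (V1 \<times> V2)" by (auto simp: bip_edges_def)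
  then show ?thesis using finV by simp
qed

lemma EE_cases:
  assumes "e \<in> EE" obtains x y where "e = {x, y}" "x \<in> V1" "y \<in> V2" "x \<noteq> y"
proof -
  from assms obtain x y where "e = {x, y}" "x \<in> V1" "y \<in> V2" by (auto simp: bip_edges_def)
  moreover from this have "x \<noteq> y" using disjV by auto
  ultimately show ?thesis using that by blast
qed

lemma vertex_degree_less:
  assumes "A \<subseteq> EE" "v \<in> V"
  shows "vertex_degree A v < card V"
proof -
  have "{e \<in> A. v \<in> e} \<subseteq> (\<lambda>w. {v, w}) ` (V - {v})"
  proof
    fix e assume e: "e \<in> {e \<in> A. v \<in> e}"
    then obtain x y where "e = {x, y}" "x \<in> V1" "y \<in> V2" "x \<noteq> y" using assms EE_cases by blast
    then show "e \<in> (\<lambda>w. {v, w}) ` (V - {v})" using e by (auto simp: insert_commute)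
  qed
  then have "vertex_degree A v \<le> card ((\<lambda>w. {v, w}) ` (V - {v}))"
    unfolding vertex_degree_def using finV by (intro card_mono) auto
  also have "\<dots> \<le> card (V - {v})" using finV by (intro card_image_le) auto
  also have "\<dots> < card V" using finV assms by (intro card_Diff1_less) auto
  finally show ?thesis .
qed

text \<open>The sign makes every edge a difference of two unit vectors.\<close>

definition signed_inc :: "nat set \<Rightarrow> nat \<Rightarrow> int" where
  "signed_inc e v = (if v \<in> e then (if v \<in> V1 then 1 else -1) else 0)"

lemma edge_vec_signed_inc: "e \<in> EE \<Longrightarrow> edge_vec (signed_inc e)"
proof -
  assume "e \<in> EE"
  then obtain x y where *: "e = {x, y}" "x \<in> V1" "y \<in> V2" "x \<noteq> y" by (rule EE_cases)
  then have "y \<notin> V1" using disjV by auto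
  with * have "signed_inc e = (\<lambda>v. of_bool (v = x) - of_bool (v = y))" by (auto simp: signed_inc_def fun_eq_iff)
  then show ?thesis unfolding edge_vec_def by blast
qed

text \<open>All edges at \<open>v\<close> have the same sign there, given by the side of
  \<open>v\<close>, so a net value is a degree difference up to sign.\<close>

lemma net_signed_inc:
  assumes "F \<subseteq> H" "finite H"
  shows "net signed_inc H F v = (if v \<in> V1 then 1 else -1) * (int (vertex_degree F v) - int (vertex_degree (H - F) v))"
proof -
  let ?s = "(if v \<in> V1 then 1 else -1) :: int"
  have fin: "finite F" "finite (H - F)" using assms finite_subset by auto
  have *: "(\<Sum>e\<in>X. signed_inc e v) = ?s * int (vertex_degree X v)" if "finite X" for X
  proof -
    have "(\<Sum>e\<in>X. signed_inc e v) = (\<Sum>e\<in>{e \<in> X. v \<in> e}. ?s)"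
      unfolding sum.inter_filter[OF that] by (intro sum.cong) (auto simp: signed_inc_def)
    then show ?thesis by (simp add: vertex_degree_def)
  qed
  have "net signed_inc H F v = (\<Sum>e\<in>F \<union> (H - F). if e \<in> F then signed_inc e v else - signed_inc e v)"
    unfolding net_def using assms by (intro sum.cong) auto
  also have "\<dots> = (\<Sum>e\<in>F. signed_inc e v) - (\<Sum>e\<in>H - F. signed_inc e v)"
    using fin by (subst sum.union_disjoint) (auto simp: sum_negf[symmetric] intro!: sum.cong)
  finally show ?thesis using *[OF fin(1)] *[OF fin(2)] by (simp add: algebra_simps)
qed

text \<open>The degrees on \<open>P\<close> are already fixed, \<open>l\<close> is the vertex
  treated next, and all other degrees are free.\<close>

definition layer :: "(nat \<Rightarrow> nat) \<Rightarrow> nat set \<Rightarrow> nat \<Rightarrow> nat \<Rightarrow> nat set set set" where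
  "layer d P l j = {A. A \<subseteq> EE \<and> (\<forall>v\<in>P. vertex_degree A v = d v) \<and> vertex_degree A l = j}"

lemma finite_layer: "finite (layer d P l j)"
  by (rule finite_subset[of _ "Pow EE"]) (auto simp: layer_def finite_EE)

text \<open>For given \<open>C\<close> and \<open>H\<close> a pair is determined by the part
  \<open>F\<close> of \<open>H\<close> that belongs to its first graph. The sum of the two degrees
  of a vertex is fixed by \<open>C\<close> and \<open>H\<close>, so prescribing both degrees amounts
  to prescribing their difference, a net value of \<open>F\<close>.\<close>

lemma card_layer_pairs:
  assumes CH: "C \<subseteq> EE" "H \<subseteq> EE" "C \<inter> H = {}"
  shows "card {(A, B) \<in> layer d P l j \<times> layer d P l k. A \<inter> B = C \<and> (A - B) \<union> (B - A) = H} =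
    (if (\<forall>v\<in>P. 2 * vertex_degree C v + vertex_degree H v = 2 * d v) \<and>
        2 * vertex_degree C l + vertex_degree H l = j + k
     then card (balanced signed_inc H P l (int k - int j)) else 0)"
    (is "card ?L = (if ?c then _ else 0)")
proof -
  have fin: "finite C" "finite H" using CH finite_EE by (blast intro: finite_subset)+
  let ?s = "(if l \<in> V1 then 1 else -1) :: int"
  define B where "B = {F. F \<subseteq> H \<and> (\<forall>v\<in>P. vertex_degree C v + vertex_degree F v = d v \<and>
      vertex_degree C v + vertex_degree (H - F) v = d v) \<and>
      vertex_degree C l + vertex_degree F l = j \<and> vertex_degree C l + vertex_degree (H - F) l = k}"
  have deg: "vertex_degree (C \<union> F) v = vertex_degree C v + vertex_degree F v" if "F \<subseteq> H" for F v
    using that CH fin by (intro vertex_degree_disjoint_Un) (auto dest: finite_subset)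
  have split: "vertex_degree H v = vertex_degree F v + vertex_degree (H - F) v" if "F \<subseteq> H" for F v
    using vertex_degree_disjoint_Un[of F "H - F" v] that fin by (auto dest: finite_subset simp: Un_absorb1)
  have "bij_betw (\<lambda>F. (C \<union> F, C \<union> (H - F))) B ?L"
  proof (rule bij_betw_byWitness[where f' = "\<lambda>(A, B). A - B"])
    show "\<forall>F\<in>B. (case (C \<union> F, C \<union> (H - F)) of (A, B) \<Rightarrow> A - B) = F"
      using CH by (auto simp: B_def)
    show "\<forall>p\<in>?L. (C \<union> (case p of (A, B) \<Rightarrow> A - B), C \<union> (H - (case p of (A, B) \<Rightarrow> A - B))) = p"
      by auto
    show "(\<lambda>F. (C \<union> F, C \<union> (H - F))) ` B \<subseteq> ?L"
      using CH by (auto simp: B_def layer_def deg)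
    show "(\<lambda>(A, B). A - B) ` ?L \<subseteq> B"
    proof
      fix F assume "F \<in> (\<lambda>(A, B). A - B) ` ?L"
      then obtain A A' where *: "A \<in> layer d P l j" "A' \<in> layer d P l k" "A \<inter> A' = C"
        "(A - A') \<union> (A' - A) = H" "F = A - A'" by auto
      have FH: "F \<subseteq> H" and A: "A = C \<union> F" "A' = C \<union> (H - F)" using *(3-5) by auto
      have "vertex_degree A v = vertex_degree C v + vertex_degree F v"
        "vertex_degree A' v = vertex_degree C v + vertex_degree (H - F) v" for v
        unfolding A by (rule deg, use FH in blast)+
      with *(1,2) FH show "F \<in> B" unfolding B_def layer_def by simp
    qed
  qed
  then have "card ?L = card B" by (simp add: bij_betw_same_card)
  \<comment> \<open>If \<open>?c\<close> fails, the degree sums are wrong and no pair exists. The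
    sign \<open>?s\<close> comes from the side of \<open>l\<close>; complementation removes it, and
    the order of \<open>j\<close> and \<open>k\<close>, at the end.\<close>
  also have "\<dots> = (if ?c then card (balanced signed_inc H P l (?s * (int j - int k))) else 0)"
  proof (cases ?c)
    case True
    have "B = balanced signed_inc H P l (?s * (int j - int k))"
    proof (rule set_eqI)
      fix F
      show "F \<in> B \<longleftrightarrow> F \<in> balanced signed_inc H P l (?s * (int j - int k))"
      proof (cases "F \<subseteq> H")
        case FH: True
        have "net signed_inc H F v = 0 \<longleftrightarrow> vertex_degree C v + vertex_degree F v = d v \<and>
            vertex_degree C v + vertex_degree (H - F) v = d v" if "v \<in> P" for v
          using True that split[OF FH, of v] by (auto simp: net_signed_inc[OF FH fin(2)])
        moreover have "net signed_inc H F l = ?s * (int j - int k) \<longleftrightarrow>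
            vertex_degree C l + vertex_degree F l = j \<and> vertex_degree C l + vertex_degree (H - F) l = k"
          using True split[OF FH, of l] by (auto simp: net_signed_inc[OF FH fin(2)])
        ultimately show ?thesis using FH by (auto simp: B_def balanced_def)
      qed (auto simp: B_def balanced_def)
    qed
    then show ?thesis using True by simp
  next
    case False
    have "B = {}"
    proof (rule ccontr)
      assume "B \<noteq> {}"
      then obtain F where F: "F \<in> B" by auto
      then have "?c" using split[of F] by (auto simp: B_def)
      then show False using False by simp
    qed
    then have "card B = 0" by simp
    then show ?thesis by (simp only: if_not_P[OF False])
  qed
  also have "card (balanced signed_inc H P l (?s * (int j - int k))) = card (balanced signed_inc H P l (int k - int j))"
    using card_balanced_uminus[of signed_inc H P l "int k - int j"] by simp
  finally show ?thesis .
qed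

definition free_weight :: "nat set \<Rightarrow> (nat \<Rightarrow> real) \<Rightarrow> nat set set \<Rightarrow> real" where
  "free_weight U x A = (\<Prod>v\<in>U. x v ^ vertex_degree A v)"

text \<open>The weight of a pair of graphs depends only on their intersection \<open>C\<close> and symmetric difference \<open>H\<close>,
  and for given \<open>C\<close> and \<open>H\<close> the number of pairs is unimodal in the difference of the degrees of \<open>l\<close>.\<close>

lemma layer_sum_log_concave:
  assumes "\<And>v. x v \<ge> 0" "j + 2 \<le> k"
  shows "(\<Sum>A\<in>layer d P l j. free_weight U x A) * (\<Sum>A\<in>layer d P l k. free_weight U x A)
    \<le> (\<Sum>A\<in>layer d P l (j + 1). free_weight U x A) * (\<Sum>A\<in>layer d P l (k - 1). free_weight U x A)"
proof -
  define W where "W = {(C, H). C \<subseteq> EE \<and> H \<subseteq> EE \<and> C \<inter> H = {}}"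
  define key where "key = (\<lambda>(A, B). (A \<inter> B, (A - B) \<union> (B - A) :: nat set set))"
  define u where "u = (\<lambda>(C, H). \<Prod>v\<in>U. x v ^ (2 * vertex_degree C v + vertex_degree H v))"
  have finW: "finite W"
    by (rule finite_subset[of _ "Pow EE \<times> Pow EE"]) (auto simp: W_def finite_EE)
  define L where "L j k = layer d P l j \<times> layer d P l k" for j k
  have prod: "(\<Sum>A\<in>layer d P l j. free_weight U x A) * (\<Sum>A\<in>layer d P l k. free_weight U x A) =
      (\<Sum>w\<in>W. real (card {p \<in> L j k. key p = w}) * u w)" for j k
  proof -
    have "(\<Sum>A\<in>layer d P l j. free_weight U x A) * (\<Sum>A\<in>layer d P l k. free_weight U x A) =
        (\<Sum>p\<in>L j k. u (key p))"
      unfolding sum_product sum.cartesian_product L_def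
    proof (rule sum.cong[OF refl], clarify)
      fix A B assume "A \<in> layer d P l j" "B \<in> layer d P l k"
      then have fin: "finite A" "finite B" by (auto simp: layer_def intro: finite_subset[OF _ finite_EE])
      have "vertex_degree A v + vertex_degree B v =
          2 * vertex_degree (A \<inter> B) v + vertex_degree ((A - B) \<union> (B - A)) v" for v
      proof -
        have "A \<inter> B \<union> (A - B) = A" "A \<inter> B \<union> (B - A) = B" "A \<inter> B \<inter> (A - B) = {}"
          "A \<inter> B \<inter> (B - A) = {}" "(A - B) \<inter> (B - A) = {}" by auto
        then show ?thesis
          using vertex_degree_disjoint_Un[of "A \<inter> B" "A - B" v] vertex_degree_disjoint_Un[of "A \<inter> B" "B - A" v]
            vertex_degree_disjoint_Un[of "A - B" "B - A" v] fin by simp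
      qed
      then show "free_weight U x A * free_weight U x B = u (key (A, B))"
        by (simp add: free_weight_def u_def key_def prod.distrib[symmetric] power_add[symmetric])
    qed
    also have "\<dots> = (\<Sum>w\<in>W. \<Sum>p\<in>{p \<in> L j k. key p = w}. u (key p))"
    proof (rule sum.group[symmetric])
      show "finite (L j k)" by (simp add: L_def finite_layer)
      show "key ` L j k \<subseteq> W" by (auto simp: L_def W_def key_def layer_def)
    qed (rule finW)
    also have "\<dots> = (\<Sum>w\<in>W. real (card {p \<in> L j k. key p = w}) * u w)"
      by (intro sum.cong) auto
    finally show ?thesis .
  qed
  have "card {p \<in> L j k. key p = w} \<le> card {p \<in> L (j + 1) (k - 1). key p = w}" if "w \<in> W" for w
  proof -
    obtain C H where w: "w = (C, H)" "C \<subseteq> EE" "H \<subseteq> EE" "C \<inter> H = {}" using \<open>w \<in> W\<close> by (auto simp: W_def)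
    have "{p \<in> L j k. key p = w} =
        {(A, B) \<in> layer d P l j \<times> layer d P l k. A \<inter> B = C \<and> (A - B) \<union> (B - A) = H}" for j k
      by (auto simp: L_def key_def w)
    then have eq: "card {p \<in> L j k. key p = w} =
      (if (\<forall>v\<in>P. 2 * vertex_degree C v + vertex_degree H v = 2 * d v) \<and>
        2 * vertex_degree C l + vertex_degree H l = j + k
       then card (balanced signed_inc H P l (int k - int j)) else 0)" for j k
      using card_layer_pairs[OF w(2-4)] by simp
    \<comment> \<open>Moving one unit of degree from the second graph to the first lowers the
      difference by 2, and \<open>j + 2 \<le> k\<close> keeps it nonnegative.\<close>
    have "card (balanced signed_inc H P l (int k - int j)) \<le> card (balanced signed_inc H P l (int (k - 1) - int (j + 1)))"
      using card_balanced_unimodal[of H signed_inc "int k - int j - 2" P l] w(3) assms(2) edge_vec_signed_inc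
      by (auto intro: finite_subset[OF _ finite_EE])
    moreover have "j + 1 + (k - 1) = j + k" using assms(2) by simp
    ultimately show ?thesis unfolding eq by simp
  qed
  moreover have "u w \<ge> 0" for w
    unfolding u_def using assms(1) by (auto intro!: prod_nonneg split: prod.split)
  ultimately show ?thesis unfolding prod by (intro sum_mono mult_right_mono) auto
qed

section \<open>Fixing the degrees one vertex at a time\<close>

definition constrained :: "(nat \<Rightarrow> nat) \<Rightarrow> nat set \<Rightarrow> nat set set set" where
  "constrained d P = {A. A \<subseteq> EE \<and> (\<forall>v\<in>P. vertex_degree A v = d v)}"

lemma finite_constrained: "finite (constrained d P)"
  by (rule finite_subset[of _ "Pow EE"]) (auto simp: constrained_def finite_EE)

text \<open>The generating polynomial of the graphs with prescribed degrees on \<open>P\<close>,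
  divided by the target monomial in the free variables. Its infimum over positive \<open>x\<close>
  is the capacity; for \<open>P = V\<close> it is the number of graphs to be bounded.\<close>

definition free_sum :: "(nat \<Rightarrow> nat) \<Rightarrow> nat set \<Rightarrow> (nat \<Rightarrow> real) \<Rightarrow> real" where
  "free_sum d P x = (\<Sum>A\<in>constrained d P. free_weight (V - P) x A) / (\<Prod>v\<in>V - P. x v ^ d v)"

text \<open>In the variable \<open>x l\<close> the numerator is a polynomial whose coefficients are
  the layer sums. Degrees are below \<open>card V\<close>, so it has \<open>card V\<close>
  coefficients, which is the factor lost.\<close>

lemma free_sum_step:
  assumes K: "K > 0" and l: "l \<in> V - P"
    and bound: "\<And>x. (\<And>v. x v > 0) \<Longrightarrow> K \<le> free_sum d P x" and x: "\<And>v. x v > 0"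
  shows "K \<le> real (card V) * free_sum d (insert l P) x"
proof -
  define U where "U = V - insert l P"
  define X where "X = (\<Prod>v\<in>U. x v ^ d v)"
  have X: "X > 0" unfolding X_def using x by (intro prod_pos) auto
  have U: "V - P = insert l U" "l \<notin> U" "finite U" using l finV by (auto simp: U_def)
  define a where "a j = (\<Sum>A\<in>layer d P l j. free_weight U x A)" for j
  have fs: "free_sum d P (x(l := t)) = (\<Sum>j<card V. a j * t ^ j) / t ^ d l / X" for t
  proof -
    have upd: "(\<Prod>v\<in>U. (x(l := t)) v ^ f v) = (\<Prod>v\<in>U. x v ^ f v)" for f :: "nat \<Rightarrow> nat"
      using U by (intro prod.cong) auto
    have "(\<Sum>A\<in>constrained d P. free_weight (V - P) (x(l := t)) A) =
        (\<Sum>A\<in>constrained d P. free_weight U x A * t ^ vertex_degree A l)"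
      unfolding free_weight_def U(1) using U upd by (intro sum.cong) auto
    also have "\<dots> = (\<Sum>j<card V. \<Sum>A\<in>{A \<in> constrained d P. vertex_degree A l = j}.
        free_weight U x A * t ^ vertex_degree A l)"
    proof (rule sum.group[symmetric])
      show "(\<lambda>A. vertex_degree A l) ` constrained d P \<subseteq> {..<card V}"
        using vertex_degree_less l by (auto simp: constrained_def)
    qed (auto simp: finite_constrained)
    also have "\<dots> = (\<Sum>j<card V. a j * t ^ j)"
      unfolding a_def sum_distrib_right
      by (intro sum.cong refl) (auto simp: constrained_def layer_def)
    finally show ?thesis using U upd by (simp add: free_sum_def U(1) X_def)
  qed
  have "K * X \<le> real (card V) * a (d l)"
  proof (rule log_concave_coeff_bound)
    show "a j \<ge> 0" for j
      unfolding a_def free_weight_def using x by (intro sum_nonneg prod_nonneg) (auto intro: less_imp_le)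
    show "a j * a k \<le> a (j + 1) * a (k - 1)" if "j + 2 \<le> k" for j k
      unfolding a_def using layer_sum_log_concave[OF less_imp_le[OF x] that] .
    show "K * X \<le> (\<Sum>j<card V. a j * t ^ j) / t ^ d l" if "t > 0" for t
    proof -
      have "K \<le> (\<Sum>j<card V. a j * t ^ j) / t ^ d l / X"
        using bound[of "x(l := t)"] that x by (simp add: fs)
      then show ?thesis using X by (simp only: pos_le_divide_eq)
    qed
  qed (use K X in auto)
  moreover have "constrained d (insert l P) = layer d P l (d l)"
    by (auto simp: constrained_def layer_def)
  then have "free_sum d (insert l P) x = a (d l) / X"
    by (simp add: free_sum_def a_def U_def X_def)
  ultimately have "K * X \<le> real (card V) * free_sum d (insert l P) x * X" using X by simp
  then show ?thesis using X by (rule mult_right_le_imp_le)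
qed

lemma prod_vertex_degree:
  fixes x :: "nat \<Rightarrow> real"
  assumes "A \<subseteq> EE"
  shows "(\<Prod>v\<in>V. x v ^ vertex_degree A v) = (\<Prod>e\<in>A. \<Prod>v\<in>e. x v)"
proof -
  have fin: "finite A" using assms finite_EE finite_subset by auto
  have "(\<Prod>v\<in>V. x v ^ vertex_degree A v) = (\<Prod>v\<in>V. \<Prod>e\<in>A. if v \<in> e then x v else 1)"
    using fin by (simp add: vertex_degree_def prod.inter_filter[symmetric])
  also have "\<dots> = (\<Prod>e\<in>A. \<Prod>v\<in>V. if v \<in> e then x v else 1)" by (rule prod.swap)
  also have "\<dots> = (\<Prod>e\<in>A. \<Prod>v\<in>e. x v)"
  proof (rule prod.cong[OF refl])
    fix e assume "e \<in> A"
    then have "{v \<in> V. v \<in> e} = e" using assms by (auto simp: bip_edges_def)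
    then show "(\<Prod>v\<in>V. if v \<in> e then x v else 1) = (\<Prod>v\<in>e. x v)"
      using finV by (simp add: prod.inter_filter[symmetric])
  qed
  finally show ?thesis .
qed

lemma sum_degree_weights:
  fixes p :: "nat set \<Rightarrow> real"
  assumes "\<And>v. v \<in> V \<Longrightarrow> (\<Sum>e\<in>{e \<in> EE. v \<in> e}. p e) = d v"
  shows "(\<Sum>v\<in>V. d v * f v) = (\<Sum>e\<in>EE. p e * (\<Sum>v\<in>e. f v))"
proof -
  have "(\<Sum>v\<in>V. d v * f v) = (\<Sum>v\<in>V. \<Sum>e\<in>EE. if v \<in> e then p e * f v else 0)"
    using finite_EE by (intro sum.cong refl) (simp add: assms[symmetric] sum.inter_filter[symmetric] sum_distrib_right)
  also have "\<dots> = (\<Sum>e\<in>EE. \<Sum>v\<in>V. if v \<in> e then p e * f v else 0)" by (rule sum.swap)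
  also have "\<dots> = (\<Sum>e\<in>EE. p e * (\<Sum>v\<in>e. f v))"
  proof (rule sum.cong[OF refl])
    fix e assume "e \<in> EE"
    then have "{v \<in> V. v \<in> e} = e" by (auto simp: bip_edges_def)
    then show "(\<Sum>v\<in>V. if v \<in> e then p e * f v else 0) = p e * (\<Sum>v\<in>e. f v)"
      using finV by (simp add: sum.inter_filter[symmetric] sum_distrib_left)
  qed
  finally show ?thesis .
qed

definition entropy :: "(nat set \<Rightarrow> real) \<Rightarrow> real" where
  "entropy p = (\<Sum>e\<in>EE. entropy_fun (p e))"

text \<open>Over all graphs the generating polynomial is the product of the factors
  \<open>1 + y e\<close>, where \<open>y e\<close> multiplies the variables at the ends of
  \<open>e\<close>. Entropy duality bounds each factor from below, and the linear terms add up to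
  the logarithm of the target monomial because \<open>p\<close> has the target degrees.\<close>

lemma exp_entropy_le_free_sum:
  assumes p: "\<And>e. e \<in> EE \<Longrightarrow> 0 \<le> p e \<and> p e \<le> 1"
    and deg: "\<And>v. v \<in> V \<Longrightarrow> (\<Sum>e\<in>{e \<in> EE. v \<in> e}. p e) = real (d v)"
    and x: "\<And>v. x v > 0"
  shows "exp (entropy p) \<le> free_sum d {} x"
proof -
  define y where "y e = (\<Prod>v\<in>e. x v)" for e
  have y: "y e > 0" for e unfolding y_def using x by (intro prod_pos) auto
  have lny: "ln (y e) = (\<Sum>v\<in>e. ln (x v))" if "e \<in> EE" for e
  proof -
    from that obtain a b where "e = {a, b}" "a \<noteq> b" by (rule EE_cases)
    then show ?thesis using x[of a] x[of b] by (simp add: y_def ln_mult)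
  qed
  have "(\<Sum>A\<in>constrained d {}. free_weight V x A) = (\<Sum>A\<in>Pow EE. (\<Prod>e\<in>A. y e) * (\<Prod>e\<in>EE - A. 1))"
    unfolding free_weight_def y_def
    by (intro sum.cong) (auto simp: constrained_def prod_vertex_degree)
  also have "\<dots> = (\<Prod>e\<in>EE. y e + 1)" using prod_add[OF finite_EE, of y "\<lambda>_. 1"] by simp
  also have "\<dots> = exp (\<Sum>e\<in>EE. ln (1 + y e))"
    using y by (simp add: exp_sum finite_EE add.commute add_pos_pos)
  finally have num: "(\<Sum>A\<in>constrained d {}. free_weight V x A) = exp (\<Sum>e\<in>EE. ln (1 + y e))" .
  have "(\<Prod>v\<in>V. x v ^ d v) = exp (\<Sum>v\<in>V. real (d v) * ln (x v))"
    using x finV by (simp add: exp_sum exp_of_nat_mult)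
  also have "(\<Sum>v\<in>V. real (d v) * ln (x v)) = (\<Sum>e\<in>EE. p e * ln (y e))"
    using sum_degree_weights[OF deg, where f = "\<lambda>v. ln (x v)"] lny by simp
  finally have "free_sum d {} x = exp ((\<Sum>e\<in>EE. ln (1 + y e)) - (\<Sum>e\<in>EE. p e * ln (y e)))"
    using num by (simp add: free_sum_def exp_diff)
  moreover have "entropy p \<le> (\<Sum>e\<in>EE. ln (1 + y e)) - (\<Sum>e\<in>EE. p e * ln (y e))"
    unfolding entropy_def sum_subtractf[symmetric]
    using entropy_fun_le_ln_add_one p y by (intro sum_mono) (simp add: le_diff_eq)
  ultimately show ?thesis by simp
qed

theorem exp_entropy_le_card:
  assumes p: "\<And>e. e \<in> EE \<Longrightarrow> 0 \<le> p e \<and> p e \<le> 1"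
    and deg: "\<And>v. v \<in> V \<Longrightarrow> (\<Sum>e\<in>{e \<in> EE. v \<in> e}. p e) = real (d v)"
  shows "exp (entropy p) \<le> real (card V) ^ card V * real (card (constrained d V))"
proof -
  \<comment> \<open>\<open>x\<close> stays arbitrary in the induction, since fixing the degree of
    \<open>l\<close> uses the bound for all positive values of \<open>x l\<close>.\<close>
  have *: "exp (entropy p) \<le> real (card V) ^ card P * free_sum d P x"
    if "finite P" "P \<subseteq> V" "\<And>v. x v > 0" for P x
    using that
  proof (induction P arbitrary: x rule: finite_induct)
    case empty
    then show ?case using exp_entropy_le_free_sum[OF p deg] by simp
  next
    case (insert l P)
    then have V: "card V > 0" "l \<in> V - P" using finV by (auto simp: card_gt_0_iff)
    let ?N = "real (card V) ^ card P"
    have "exp (entropy p) / ?N \<le> real (card V) * free_sum d (insert l P) x"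
    proof (rule free_sum_step[OF _ V(2)])
      show "exp (entropy p) / ?N \<le> free_sum d P x" if "\<And>v. x v > 0" for x
        using insert.IH[of x] insert.prems that V by (simp add: field_simps)
    qed (use insert V in auto)
    then show ?case using insert V by (simp add: field_simps)
  qed
  have "free_sum d V (\<lambda>_. 1) = real (card (constrained d V))"
    by (simp add: free_sum_def free_weight_def)
  then show ?thesis using *[of V "\<lambda>_. 1"] finV by simp
qed

end

section \<open>The maximum entropy matrix\<close>

lemma continuous_on_entropy_fun: "continuous_on {0..1} entropy_fun"
proof -
  have *: "continuous_on {0..1} (\<lambda>x::real. x * ln x)"
    unfolding continuous_on_def
  proof
    fix x :: real assume x: "x \<in> {0..1}"
    show "((\<lambda>x. x * ln x) \<longlongrightarrow> x * ln x) (at x within {0..1})"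
    proof (cases "x = 0")
      case True
      \<comment> \<open>The convention \<open>ln 0 = 0\<close> agrees with this limit. The endpoint
        1 of the entropy is later reduced to this one by the reflection
        \<open>1 - x\<close>.\<close>
      have "((\<lambda>x::real. x * ln x) \<longlongrightarrow> 0) (at_right 0)" by real_asymp
      moreover have "at (0::real) within {0..1} = at_right 0"
        by (rule at_within_Icc_at_right) simp
      ultimately show ?thesis using True by simp
    next
      case False
      then show ?thesis using x by (auto intro!: tendsto_intros)
    qed
  qed
  have "continuous_on {0..1} (\<lambda>x::real. (1 - x) * ln (1 - x))"
    by (rule continuous_on_compose2[OF *, of "{0..1}" "\<lambda>x. 1 - x"]) (auto intro!: continuous_intros)
  then show ?thesis unfolding entropy_fun_def
    using continuous_on_diff[OF continuous_on_minus[OF *]] by simp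
qed

lemma mult_ln_diff_less:
  fixes a b :: real
  assumes "a \<ge> 0" "b > 0" "a \<noteq> b"
  shows "a * ln b - a * ln a < b - a"
proof (cases "a = 0")
  case False
  then have "ln (b / a) < b / a - 1"
    using assms ln_le_minus_one[of "b / a"] ln_eq_minus_one[of "b / a"] by force
  then have "a * ln (b / a) < a * (b / a - 1)" using False assms by simp
  then show ?thesis using False assms by (simp add: ln_div algebra_simps)
qed (use assms in auto)

text \<open>The cross entropy against the midpoint \<open>m\<close> is affine, so the Gibbs bounds
  for \<open>a\<close> and \<open>b\<close> average to the entropy of \<open>m\<close>; the bound
  for \<open>a\<close> is strict because \<open>a \<noteq> m\<close>.\<close>

lemma entropy_fun_strict_midpoint:
  assumes "0 \<le> a" "a \<le> 1" "0 \<le> b" "b \<le> 1" "a \<noteq> b"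
  shows "(entropy_fun a + entropy_fun b) / 2 < entropy_fun ((a + b) / 2)"
proof -
  define m where "m = (a + b) / 2"
  have m: "0 < m" "m < 1" "a \<noteq> m" and am: "a = 2 * m - b"
    using assms by (auto simp: m_def field_simps)
  have "entropy_fun a < - a * ln m - (1 - a) * ln (1 - m)"
    using mult_ln_diff_less[of a m] mult_ln_diff_le[of "1 - a" "1 - m"] assms m
    by (simp add: entropy_fun_def)
  moreover have "entropy_fun b \<le> - b * ln m - (1 - b) * ln (1 - m)"
    using entropy_fun_le_cross[of b m] assms m by simp
  ultimately have "entropy_fun a + entropy_fun b < 2 * entropy_fun m"
    unfolding entropy_fun_def am by (simp add: algebra_simps)
  then show ?thesis by (simp add: m_def)
qed

lemma entropy_fun_midpoint:
  assumes "0 \<le> a" "a \<le> 1" "0 \<le> b" "b \<le> 1"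
  shows "(entropy_fun a + entropy_fun b) / 2 \<le> entropy_fun ((a + b) / 2)"
  using entropy_fun_strict_midpoint[OF assms] by (cases "a = b") auto

text \<open>Extensional functions form a full product whose factors outside the index set are
  singletons, the form to which Tychonoff's theorem applies.\<close>

lemma PiE_eq_PiE_UNIV: "U \<rightarrow>\<^sub>E S = PiE UNIV (\<lambda>u. if u \<in> U then S else {undefined})"
  by (auto simp: PiE_iff extensional_def split: if_splits)

lemma exp_le_of_mult_ln_le:
  fixes x q h :: real
  assumes "0 < x" "0 < q" "x * (- ln q) \<le> h"
  shows "exp (- (h / x)) \<le> q"
proof -
  have "- ln q \<le> h / x" using assms by (subst pos_le_divide_eq) (auto simp: mult.commute)
  then have "exp (- (h / x)) \<le> exp (ln q)" by simp
  then show ?thesis using assms by simp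
qed

section \<open>The maximiser and its optimality condition\<close>

locale entropy_polytope =
  fixes n1 n2 :: nat and D1 D2 :: "nat \<Rightarrow> nat"
  assumes interior: "nonempty_interior n1 n2 D1 D2"
begin

abbreviation "UU \<equiv> {1..n1} \<times> {1..n2}"
abbreviation "PP \<equiv> bip_polytope n1 n2 D1 D2"

definition H :: "(nat \<times> nat \<Rightarrow> real) \<Rightarrow> real" where
  "H X = (\<Sum>u\<in>UU. entropy_fun (X u))"

lemma matrix_entropy_eq: "matrix_entropy n1 n2 X = H X"
  by (simp add: matrix_entropy_def H_def sum.cartesian_product case_prod_unfold)

lemma PP_range: "X \<in> PP \<Longrightarrow> u \<in> UU \<Longrightarrow> 0 \<le> X u \<and> X u \<le> 1"
  by (auto simp: bip_polytope_def PiE_iff)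

lemma convex_comb_PP:
  assumes "X \<in> PP" "Y \<in> PP" "0 \<le> t" "t \<le> 1"
  shows "restrict (\<lambda>u. (1 - t) * X u + t * Y u) UU \<in> PP"
proof -
  have "0 \<le> (1 - t) * X u + t * Y u" "(1 - t) * X u + t * Y u \<le> 1" if "u \<in> UU" for u
  proof -
    show "0 \<le> (1 - t) * X u + t * Y u" using PP_range assms that by auto
    have "(1 - t) * X u + t * Y u \<le> (1 - t) * 1 + t * 1"
      using PP_range assms that by (intro add_mono mult_left_mono) auto
    then show "(1 - t) * X u + t * Y u \<le> 1" by simp
  qed
  moreover have "(1 - t) * x + t * x = x" for x by (simp add: algebra_simps)
  ultimately show ?thesis using assms(1,2)
    by (auto simp: bip_polytope_def sum.distrib sum_distrib_left[symmetric])
qed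

lemma compact_PP: "compact PP"
proof -
  let ?S = "\<lambda>u. if u \<in> UU then {0..1} else {undefined} :: real set"
  have "compactin (product_topology (\<lambda>_. euclidean) UNIV) (PiE UNIV ?S)"
    by (simp add: compactin_PiE)
  then have 1: "compact (UU \<rightarrow>\<^sub>E {0..1::real})"
    unfolding PiE_eq_PiE_UNIV by (simp only: euclidean_product_topology compactin_euclidean_iff)
  have "closed {X :: nat \<times> nat \<Rightarrow> real.
        (\<forall>i\<in>{1..n1}. (\<Sum>j\<in>{1..n2}. X (i, j)) = real (D1 i)) \<and>
        (\<forall>j\<in>{1..n2}. (\<Sum>i\<in>{1..n1}. X (i, j)) = real (D2 j))}"
    unfolding Ball_def
    by (intro closed_Collect_conj closed_Collect_all closed_Collect_imp open_Collect_const closed_Collect_eq continuous_intros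
        continuous_on_product_coordinates)
  from compact_Int_closed[OF 1 this] show ?thesis
    by (rule arg_cong[where f = compact, THEN iffD1, rotated]) (auto simp: bip_polytope_def)
qed

lemma continuous_on_H: "continuous_on PP H"
  unfolding H_def
proof (intro continuous_intros)
  fix u assume "u \<in> UU"
  then show "continuous_on PP (\<lambda>X. entropy_fun (X u))"
    using PP_range
    by (intro continuous_on_compose2[OF continuous_on_entropy_fun]
        continuous_on_subset[OF continuous_on_product_coordinates]) auto
qed

abbreviation "pm \<equiv> max_entropy_matrix n1 n2 D1 D2"

text \<open>Compactness gives a maximiser and strict concavity at midpoints its uniqueness; both are
  needed before the definite description denotes anything.\<close>

lemma max_entropy: "pm \<in> PP \<and> (\<forall>Y\<in>PP. H Y \<le> H pm)"
proof -
  have "PP \<noteq> {}" using interior by (auto simp: nonempty_interior_def)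
  then obtain X where X: "X \<in> PP" "\<And>Y. Y \<in> PP \<Longrightarrow> H Y \<le> H X"
    using continuous_attains_sup[OF compact_PP _ continuous_on_H] by auto
  have uniq: "Y = X" if Y: "Y \<in> PP" "\<And>Z. Z \<in> PP \<Longrightarrow> H Z \<le> H Y" for Y
  proof (rule ccontr)
    assume "Y \<noteq> X"
    then obtain u where u: "u \<in> UU" "Y u \<noteq> X u"
      using PiE_ext[of Y UU "\<lambda>_. {0..1}" X] X(1) Y(1) unfolding bip_polytope_def by blast
    define Z where "Z = restrict (\<lambda>u. (1 - 1/2) * X u + 1/2 * Y u) UU"
    have Z: "Z \<in> PP" unfolding Z_def using X Y by (intro convex_comb_PP) auto
    have Zu: "Z u = (X u + Y u) / 2" if "u \<in> UU" for u using that by (auto simp: Z_def)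
    have "(\<Sum>u\<in>UU. (entropy_fun (X u) + entropy_fun (Y u)) / 2) < H Z"
      unfolding H_def
    proof (rule sum_strict_mono_ex1)
      show "\<forall>u\<in>UU. (entropy_fun (X u) + entropy_fun (Y u)) / 2 \<le> entropy_fun (Z u)"
        using PP_range[OF X(1)] PP_range[OF Y(1)] entropy_fun_midpoint by (metis Zu)
      show "\<exists>u\<in>UU. (entropy_fun (X u) + entropy_fun (Y u)) / 2 < entropy_fun (Z u)"
        using PP_range[OF X(1) u(1)] PP_range[OF Y(1) u(1)] u entropy_fun_strict_midpoint[of "X u" "Y u"]
        by (intro bexI[of _ u]) (auto simp: Zu)
    qed simp
    then have "(H X + H Y) / 2 < H Z" by (simp add: H_def sum.distrib flip: sum_divide_distrib)
    moreover have "H Z \<le> H X" "H Z \<le> H Y" using X Y Z by auto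
    ultimately show False by simp
  qed
  have "pm = X"
    unfolding max_entropy_matrix_def
    by (rule the_equality) (auto simp: is_arg_max_def matrix_entropy_eq not_less X intro!: uniq)
  then show ?thesis using X by auto
qed

lemmas pm_in_PP = max_entropy[THEN conjunct1]
lemmas H_le_H_pm = max_entropy[THEN conjunct2, rule_format]

text \<open>Cross entropy against the product law with parameters \<open>Q\<close>. It is affine in
  \<open>X\<close>, equals the entropy of \<open>Q\<close> for \<open>X = Q\<close>, and for the 0-1
  matrix of a graph it is minus the logarithm of the probability of that graph.\<close>

definition cross :: "(nat \<times> nat \<Rightarrow> real) \<Rightarrow> (nat \<times> nat \<Rightarrow> real) \<Rightarrow> real" where
  "cross X Q = (\<Sum>u\<in>UU. - X u * ln (Q u) - (1 - X u) * ln (1 - Q u))"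

text \<open>Concavity bounds \<open>H\<close> at \<open>pm\<close> by its tangent at a point of the segment from \<open>pm\<close> to \<open>Y\<close>.\<close>

lemma cross_segment_le:
  assumes Y: "Y \<in> PP" and t: "0 < t" "t \<le> 1"
    and Q: "\<And>u. u \<in> UU \<Longrightarrow> Q u = (1 - t) * pm u + t * Y u" "\<And>u. u \<in> UU \<Longrightarrow> 0 < Q u \<and> Q u < 1"
  shows "cross Y Q \<le> H pm"
proof -
  have "H (restrict (\<lambda>u. (1 - t) * pm u + t * Y u) UU) \<le> H pm"
    using Y t pm_in_PP by (intro H_le_H_pm convex_comb_PP) auto
  then have "H Q \<le> H pm" by (simp add: H_def Q(1))
  moreover have "H Q = (1 - t) * cross pm Q + t * cross Y Q"
  proof -
    have "entropy_fun (Q u) = (1 - t) * (- pm u * ln (Q u) - (1 - pm u) * ln (1 - Q u)) +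
        t * (- Y u * ln (Q u) - (1 - Y u) * ln (1 - Q u))" if "u \<in> UU" for u
    proof -
      have "entropy_fun (Q u) = - ((1 - t) * pm u + t * Y u) * ln (Q u)
          - (1 - ((1 - t) * pm u + t * Y u)) * ln (1 - Q u)"
        by (simp only: entropy_fun_def flip: Q(1)[OF that])
      then show ?thesis by (simp add: algebra_simps)
    qed
    then show ?thesis by (simp add: H_def cross_def sum_distrib_left sum.distrib)
  qed
  moreover have "H pm \<le> cross pm Q"
    unfolding H_def cross_def using PP_range[OF pm_in_PP] Q(2)
    by (intro sum_mono entropy_fun_le_cross) auto
  then have "(1 - t) * H pm \<le> (1 - t) * cross pm Q" using t by (intro mult_left_mono) auto
  ultimately have "t * cross Y Q \<le> t * H pm" by (simp add: algebra_simps)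
  then show ?thesis using t by simp
qed

text \<open>At a point \<open>Q\<close> between \<open>pm\<close> and an interior matrix
  \<open>X\<close>, \<open>cross X Q\<close> is at most \<open>H pm\<close>, hence so is each of its
  nonnegative summands. This keeps \<open>Q u\<close> away from 0 and 1 by a margin that does not
  depend on the distance from \<open>Q\<close> to \<open>pm\<close>.\<close>

lemma max_entropy_interior:
  assumes "u \<in> UU" shows "0 < pm u" "pm u < 1"
proof -
  obtain X where X: "X \<in> PP" "\<And>u. u \<in> UU \<Longrightarrow> 0 < X u \<and> X u < 1"
    using interior by (auto simp: nonempty_interior_def)
  have u: "0 < X u" "X u < 1" "0 \<le> pm u" "pm u \<le> 1"
    using X assms PP_range[OF pm_in_PP] by auto
  \<comment> \<open>The margin \<open>c\<close> does not involve \<open>t\<close>. Since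
    \<open>Q u\<close> and \<open>pm u\<close> differ by at most \<open>t\<close>, a choice of
    \<open>t < c\<close> forces \<open>pm u\<close> off the boundary.\<close>
  define c where "c = min (exp (- (H pm / X u))) (exp (- (H pm / (1 - X u))))"
  define t where "t = min 1 (c / 2)"
  have ct: "0 < c" "0 < t" "t \<le> 1" "t < c"
  proof -
    show "0 < c" by (simp add: c_def)
    then show "0 < t" "t \<le> 1" "t < c" by (auto simp: t_def)
  qed
  define Q where "Q u = (1 - t) * pm u + t * X u" for u
  have Q: "0 < Q u" "Q u < 1" if "u \<in> UU" for u
  proof -
    have *: "0 \<le> pm u" "pm u \<le> 1" "0 < X u" "X u < 1"
      using X that PP_range[OF pm_in_PP] by auto
    then show "0 < Q u" unfolding Q_def using ct by (intro add_nonneg_pos) auto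
    have "(1 - t) * pm u + t * X u < (1 - t) * 1 + t * 1"
      using * ct by (intro add_le_less_mono mult_left_mono mult_strict_left_mono) auto
    then show "Q u < 1" by (simp add: Q_def)
  qed
  define \<alpha> \<beta> where "\<alpha> w = X w * (- ln (Q w))" and "\<beta> w = (1 - X w) * (- ln (1 - Q w))" for w
  have nonneg: "0 \<le> \<alpha> w" "0 \<le> \<beta> w" if "w \<in> UU" for w
    unfolding \<alpha>_def \<beta>_def by (rule mult_nonneg_nonneg; use Q[OF that] X(2)[OF that] in simp)+
  have "\<alpha> u + \<beta> u \<le> (\<Sum>w\<in>UU. \<alpha> w + \<beta> w)"
    by (rule member_le_sum[OF assms]) (use nonneg in simp_all)
  also have "\<dots> = cross X Q"
    unfolding cross_def by (rule sum.cong) (simp_all add: \<alpha>_def \<beta>_def)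
  also have "\<dots> \<le> H pm" using X ct Q by (intro cross_segment_le) (auto simp: Q_def)
  finally have "\<alpha> u \<le> H pm" "\<beta> u \<le> H pm" using nonneg[OF assms] by simp_all
  note le = this[unfolded \<alpha>_def \<beta>_def]
  have "exp (- (H pm / X u)) \<le> Q u" "exp (- (H pm / (1 - X u))) \<le> 1 - Q u"
    using exp_le_of_mult_ln_le[OF u(1) Q(1)[OF assms] le(1)]
      exp_le_of_mult_ln_le[OF _ _ le(2)] u(2) Q(2)[OF assms] by simp_all
  then have c: "c \<le> Q u" "c \<le> 1 - Q u" unfolding c_def by (simp_all add: min_le_iff_disj)
  have "t * X u \<le> t" "t * pm u \<le> t" "0 \<le> t * pm u" "0 \<le> t * X u"
    using u ct by (auto simp: mult_left_le)
  moreover have "Q u = pm u - t * pm u + t * X u" by (simp add: Q_def algebra_simps)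
  ultimately show "0 < pm u" "pm u < 1" using c ct by linarith+
qed

text \<open>The limit of the bound on the segment as \<open>t\<close> tends to 0; the logarithms are
  continuous there because \<open>pm\<close> is interior.\<close>

lemma cross_le_max_entropy:
  assumes Y: "Y \<in> PP"
  shows "cross Y pm \<le> H pm"
proof -
  have "((\<lambda>t. cross Y (\<lambda>u. (1 - t) * pm u + t * Y u)) \<longlongrightarrow> cross Y (\<lambda>u. (1 - 0) * pm u + 0 * Y u)) (at_right 0)"
    unfolding cross_def
  proof (intro tendsto_sum tendsto_diff tendsto_mult tendsto_ln tendsto_const tendsto_add tendsto_minus tendsto_ident_at)
    fix u assume "u \<in> UU"
    from max_entropy_interior[OF this]
    show "(1 - 0) * pm u + 0 * Y u \<noteq> 0" "1 - ((1 - 0) * pm u + 0 * Y u) \<noteq> 0" by auto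
  qed
  moreover have "\<forall>\<^sub>F t in at_right 0. cross Y (\<lambda>u. (1 - t) * pm u + t * Y u) \<le> H pm"
    unfolding eventually_at_right_field
  proof (intro exI[of _ 1] conjI allI impI)
    fix t :: real assume t: "0 < t" "t < 1"
    show "cross Y (\<lambda>u. (1 - t) * pm u + t * Y u) \<le> H pm"
    proof (rule cross_segment_le[OF Y])
      fix u assume u: "u \<in> UU"
      note * = max_entropy_interior[OF u] PP_range[OF Y u]
      have "(1 - t) * pm u + t * Y u < (1 - t) * 1 + t * 1"
        using * t by (intro add_less_le_mono mult_left_mono mult_strict_left_mono) auto
      moreover have "0 < (1 - t) * pm u + t * Y u" using * t by (intro add_pos_nonneg) auto
      ultimately show "0 < (1 - t) * pm u + t * Y u \<and> (1 - t) * pm u + t * Y u < 1" by simp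
    qed (use t in auto)
  qed auto
  ultimately have "cross Y (\<lambda>u. (1 - 0) * pm u + 0 * Y u) \<le> H pm"
    by (rule tendsto_upperbound) auto
  then show ?thesis by simp
qed

end

section \<open>Comparing the uniform and the product measure\<close>

definition edge_prob :: "nat set set \<Rightarrow> (nat set \<Rightarrow> real) \<Rightarrow> nat set set \<Rightarrow> real" where
  "edge_prob E p A = (\<Prod>e\<in>A. p e) * (\<Prod>e\<in>E - A. 1 - p e)"

sublocale entropy_polytope \<subseteq> bipartition "bip_set1 n1" "bip_set2 n1 n2"
  by unfold_locales (auto simp: bip_set1_def bip_set2_def)

context entropy_polytope
begin

abbreviation "dd \<equiv> combined_degrees n1 D1 D2"

text \<open>The vertex of set 1 is the smaller one of an edge, so \<open>Min e\<close> is its row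
  and \<open>Max e - n1\<close> its column. The value 0 on all other sets permits sums over
  arbitrary pairs of vertices.\<close>

definition pe :: "nat set \<Rightarrow> real" where
  "pe e = (if e \<in> EE then pm (Min e, Max e - n1) else 0)"

lemma edge_in_EE: "i \<in> {1..n1} \<Longrightarrow> j \<in> {1..n2} \<Longrightarrow> {i, n1 + j} \<in> EE"
  unfolding bip_edges_def bip_set1_def bip_set2_def by fastforce

lemma EE_obtain:
  assumes "e \<in> EE" obtains i j where "e = {i, n1 + j}" "i \<in> {1..n1}" "j \<in> {1..n2}"
proof -
  obtain i y where "e = {i, y}" "i \<in> {1..n1}" "y \<in> {n1 + 1..n1 + n2}"
    using assms unfolding bip_edges_def bip_set1_def bip_set2_def by blast
  then show ?thesis by (intro that[of i "y - n1"]) auto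
qed

lemma pe_edge: "i \<in> {1..n1} \<Longrightarrow> j \<in> {1..n2} \<Longrightarrow> pe {i, n1 + j} = pm (i, j)"
  using edge_in_EE by (simp add: pe_def)

lemma edge_eq_iff:
  "i \<in> {1..n1} \<Longrightarrow> i' \<in> {1..n1} \<Longrightarrow> {i, n1 + j} = {i', n1 + j'} \<longleftrightarrow> i = i' \<and> j = j'"
  by (auto simp: doubleton_eq_iff)

lemma bij_edges: "bij_betw (\<lambda>(i, j). {i, n1 + j}) UU EE"
proof (rule bij_betw_imageI)
  show "inj_on (\<lambda>(i, j). {i, n1 + j}) UU"
    by (auto simp: inj_on_def doubleton_eq_iff)
  show "(\<lambda>(i, j). {i, n1 + j}) ` UU = EE"
    using edge_in_EE by (fastforce elim!: EE_obtain)
qed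

lemma sum_EE: "(\<Sum>e\<in>EE. g e) = (\<Sum>(i, j)\<in>UU. g {i, n1 + j})"
  using sum.reindex_bij_betw[OF bij_edges, of g] by (simp add: case_prod_unfold)

lemma sum_incident_row:
  assumes "i \<in> {1..n1}"
  shows "(\<Sum>e\<in>{e \<in> EE. i \<in> e}. g e) = (\<Sum>j\<in>{1..n2}. g {i, n1 + j})"
proof (rule sum.reindex_bij_betw[symmetric], rule bij_betw_imageI)
  show "inj_on (\<lambda>j. {i, n1 + j}) {1..n2}" by (auto simp: inj_on_def doubleton_eq_iff)
  show "(\<lambda>j. {i, n1 + j}) ` {1..n2} = {e \<in> EE. i \<in> e}"
    using assms edge_in_EE by (fastforce elim!: EE_obtain)
qed

lemma sum_incident_column:
  assumes "j \<in> {1..n2}"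
  shows "(\<Sum>e\<in>{e \<in> EE. n1 + j \<in> e}. g e) = (\<Sum>i\<in>{1..n1}. g {i, n1 + j})"
proof (rule sum.reindex_bij_betw[symmetric], rule bij_betw_imageI)
  show "inj_on (\<lambda>i. {i, n1 + j}) {1..n1}" by (auto simp: inj_on_def doubleton_eq_iff)
  show "(\<lambda>i. {i, n1 + j}) ` {1..n1} = {e \<in> EE. n1 + j \<in> e}"
    using assms edge_in_EE by (fastforce elim!: EE_obtain)
qed

lemma pe_range: "e \<in> EE \<Longrightarrow> 0 < pe e \<and> pe e < 1"
  using max_entropy_interior by (elim EE_obtain) (simp add: pe_edge)

lemma V_cases:
  assumes "v \<in> V"
  obtains "v \<in> {1..n1}" | j where "v = n1 + j" "j \<in> {1..n2}"
proof (cases "v \<le> n1")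
  case True
  then show ?thesis using assms by (intro that(1)) (auto simp: bip_set1_def bip_set2_def)
next
  case False
  then show ?thesis using assms by (intro that(2)[of "v - n1"]) (auto simp: bip_set1_def bip_set2_def)
qed

lemma pe_degree:
  assumes "v \<in> V"
  shows "(\<Sum>e\<in>{e \<in> EE. v \<in> e}. pe e) = real (dd v)"
  using assms
proof (cases rule: V_cases)
  case 1
  then show ?thesis using pm_in_PP
    by (simp add: sum_incident_row pe_edge bip_polytope_def combined_degrees_def)
next
  case (2 j)
  then show ?thesis using pm_in_PP
    by (simp add: sum_incident_column pe_edge bip_polytope_def combined_degrees_def)
qed

lemma entropy_pe: "entropy pe = H pm"
  unfolding entropy_def H_def sum_EE by (intro sum.cong) (auto simp: pe_edge)

text \<open>The 0-1 matrix of a graph with these degrees lies in the polytope, and its cross entropy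
  against \<open>pm\<close> is minus the logarithm of its probability, so
  \<open>cross_le_max_entropy\<close> applies.\<close>

lemma exp_entropy_le_edge_prob:
  assumes A: "A \<in> constrained dd V"
  shows "exp (- H pm) \<le> edge_prob EE pe A"
proof -
  define Y where "Y = restrict (\<lambda>(i, j). of_bool ({i, n1 + j} \<in> A) :: real) UU"
  have AE: "A \<subseteq> EE" using A by (auto simp: constrained_def)
  have deg: "(\<Sum>e\<in>{e \<in> EE. v \<in> e}. of_bool (e \<in> A) :: real) = real (dd v)" if "v \<in> V" for v
  proof -
    have "(\<Sum>e\<in>{e \<in> EE. v \<in> e}. of_bool (e \<in> A)) = real (card ({e \<in> EE. v \<in> e} \<inter> {e. e \<in> A}))"
      by (simp add: finite_EE)
    also have "{e \<in> EE. v \<in> e} \<inter> {e. e \<in> A} = {e \<in> A. v \<in> e}" using AE by auto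
    finally show ?thesis using A that by (simp add: constrained_def vertex_degree_def)
  qed
  have "Y \<in> PP"
    unfolding bip_polytope_def
  proof (intro CollectI conjI ballI)
    show "Y \<in> UU \<rightarrow>\<^sub>E {0..1}" by (auto simp: Y_def)
    fix i assume i: "i \<in> {1..n1}"
    then have "i \<in> V" by (simp add: bip_set1_def)
    from deg[OF this] show "(\<Sum>j = 1..n2. Y (i, j)) = real (D1 i)"
      unfolding sum_incident_row[OF i] using i by (simp add: Y_def combined_degrees_def)
  next
    fix j assume j: "j \<in> {1..n2}"
    then have "n1 + j \<in> V" by (simp add: bip_set2_def)
    from deg[OF this] show "(\<Sum>i = 1..n1. Y (i, j)) = real (D2 j)"
      unfolding sum_incident_column[OF j] using j by (simp add: Y_def combined_degrees_def)
  qed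
  then have "- H pm \<le> - cross Y pm" using cross_le_max_entropy by simp
  also have "- cross Y pm = (\<Sum>e\<in>EE. of_bool (e \<in> A) * ln (pe e) + (1 - of_bool (e \<in> A)) * ln (1 - pe e))"
    unfolding cross_def sum_EE sum_negf[symmetric] by (intro sum.cong) (auto simp: Y_def pe_edge)
  also have "\<dots> = (\<Sum>e\<in>A \<union> (EE - A). if e \<in> A then ln (pe e) else ln (1 - pe e))"
    using AE by (intro sum.cong) auto
  also have "\<dots> = (\<Sum>e\<in>A. ln (pe e)) + (\<Sum>e\<in>EE - A. ln (1 - pe e))"
    using finite_EE AE by (subst sum.union_disjoint) (auto dest: finite_subset intro!: arg_cong2[where f = "(+)"] sum.cong)
  finally have "exp (- H pm) \<le> exp (\<dots>)" by simp
  also have "\<dots> = edge_prob EE pe A"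
    unfolding edge_prob_def exp_add using AE finite_EE pe_range
    by (subst (1 2) exp_sum) (auto dest: finite_subset intro!: arg_cong2[where f = "(*)"] prod.cong)
  finally show ?thesis .
qed

text \<open>The existence of a graph is read off from the count, whose lower bound is
  positive.\<close>

lemma card_constrained_pos: "card (constrained dd V) > 0"
proof -
  have "0 < exp (entropy pe)" by simp
  also have "\<dots> \<le> real (card V) ^ card V * real (card (constrained dd V))"
    using pe_range pe_degree by (intro exp_entropy_le_card) (auto intro: less_imp_le)
  finally show ?thesis by (auto simp: zero_less_mult_iff)
qed

text \<open>The entropy cancels between the lower bound for the number of graphs and that for the
  probability of one graph, so only the factor lost in the count remains.\<close>

lemma uniform_le_edge_prob:
  assumes A: "A \<in> constrained dd V"
  shows "1 / real (card (constrained dd V)) \<le> real (card V) ^ card V * edge_prob EE pe A"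
proof -
  let ?c = "real (card (constrained dd V))" and ?n = "real (card V) ^ card V"
  have "exp (H pm) \<le> ?n * ?c"
    using pe_range pe_degree unfolding entropy_pe[symmetric]
    by (intro exp_entropy_le_card) (auto intro: less_imp_le)
  then have "exp (H pm) * exp (- H pm) \<le> ?n * ?c * edge_prob EE pe A"
    using exp_entropy_le_edge_prob[OF A] by (intro mult_mono) auto
  then have "1 \<le> ?n * edge_prob EE pe A * ?c" by (simp add: exp_minus algebra_simps)
  then show ?thesis using card_constrained_pos by (simp add: pos_divide_le_eq)
qed

end

section \<open>Weighted edge deviations\<close>

lemma exp_le_quadratic:
  fixes y :: real
  assumes "\<bar>y\<bar> \<le> 1"
  shows "exp y \<le> 1 + y + y\<^sup>2"
proof (cases "y \<ge> 0")
  case True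
  then show ?thesis using exp_bound[of y] assms by simp
next
  case False
  define z where "z = - y"
  have z: "0 \<le> z" "z \<le> 1" using False assms by (auto simp: z_def)
  \<comment> \<open>The product is \<open>1 + z ^ 3\<close>.\<close>
  have "1 \<le> (1 + z) * (1 - z + z\<^sup>2)" using z by (simp add: algebra_simps power2_eq_square)
  also have "\<dots> \<le> exp z * (1 - z + z\<^sup>2)"
    using z exp_ge_add_one_self[of z] by (intro mult_right_mono) auto
  finally have "exp (- z) \<le> 1 - z + z\<^sup>2" by (simp add: exp_minus field_simps)
  then show ?thesis by (simp add: z_def)
qed

text \<open>The linear terms cancel and the quadratic ones give the variance, at most
  \<open>p\<close>. An exponent proportional to \<open>p\<close> lets the bounds at a vertex add up
  to its degree and not to the number of possible neighbours.\<close>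

lemma centered_bernoulli_mgf_le:
  fixes p c :: real
  assumes p: "0 \<le> p" "p \<le> 1" and c: "\<bar>c\<bar> \<le> 1"
  shows "p * exp (c * (1 - p)) + (1 - p) * exp (- c * p) \<le> exp (c\<^sup>2 * p)"
proof -
  have "\<bar>c\<bar> * (1 - p) \<le> 1 * 1" "\<bar>c\<bar> * p \<le> 1 * 1"
    using p c by (intro mult_mono; simp)+
  then have "\<bar>c * (1 - p)\<bar> \<le> 1" "\<bar>- c * p\<bar> \<le> 1"
    using p by (simp_all add: abs_mult)
  then have "p * exp (c * (1 - p)) + (1 - p) * exp (- c * p) \<le>
      p * (1 + c * (1 - p) + (c * (1 - p))\<^sup>2) + (1 - p) * (1 + - c * p + (- c * p)\<^sup>2)"
    using p by (intro add_mono mult_left_mono exp_le_quadratic) auto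
  also have "\<dots> = 1 + c\<^sup>2 * p - c\<^sup>2 * p\<^sup>2" by (simp add: power2_eq_square algebra_simps)
  also have "\<dots> \<le> 1 + c\<^sup>2 * p" by simp
  also have "\<dots> \<le> exp (c\<^sup>2 * p)" by (rule exp_ge_add_one_self)
  finally show ?thesis .
qed

text \<open>Subsets of a disjoint union are families of subsets of the parts. With the point masses
  inside \<open>g\<close>, this is the independence of the parts.\<close>

lemma sum_Pow_UNION:
  fixes g :: "'x \<Rightarrow> 'e set \<Rightarrow> real"
  assumes W: "finite W" "\<And>x. x \<in> W \<Longrightarrow> finite (E x)"
    and disj: "\<And>x y. x \<in> W \<Longrightarrow> y \<in> W \<Longrightarrow> x \<noteq> y \<Longrightarrow> E x \<inter> E y = {}"
  shows "(\<Sum>A\<in>Pow (\<Union>x\<in>W. E x). \<Prod>x\<in>W. g x (A \<inter> E x)) = (\<Prod>x\<in>W. \<Sum>B\<in>Pow (E x). g x B)"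
proof -
  have int: "(\<Union>y\<in>W. f y) \<inter> E x = f x" if "f \<in> PiE W (\<lambda>x. Pow (E x))" "x \<in> W" for f x
    using that disj[of x] by (fastforce simp: PiE_iff)
  have "bij_betw (\<lambda>f. \<Union>x\<in>W. f x) (PiE W (\<lambda>x. Pow (E x))) (Pow (\<Union>x\<in>W. E x))"
  proof (rule bij_betw_byWitness[where f' = "\<lambda>A. restrict (\<lambda>x. A \<inter> E x) W"])
    show "\<forall>f\<in>PiE W (\<lambda>x. Pow (E x)). restrict (\<lambda>x. (\<Union>x\<in>W. f x) \<inter> E x) W = f"
    proof
      fix f assume f: "f \<in> PiE W (\<lambda>x. Pow (E x))"
      show "restrict (\<lambda>x. (\<Union>x\<in>W. f x) \<inter> E x) W = f"
        using int[OF f] f by (auto simp: fun_eq_iff PiE_iff extensional_def restrict_def)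
    qed
  qed (auto simp: PiE_iff)
  from sum.reindex_bij_betw[OF this, of "\<lambda>A. \<Prod>x\<in>W. g x (A \<inter> E x)"]
  have "(\<Sum>A\<in>Pow (\<Union>x\<in>W. E x). \<Prod>x\<in>W. g x (A \<inter> E x)) =
      (\<Sum>f\<in>PiE W (\<lambda>x. Pow (E x)). \<Prod>x\<in>W. g x (f x))"
    using int by simp
  also have "\<dots> = (\<Prod>x\<in>W. \<Sum>B\<in>Pow (E x). g x B)"
    using W by (simp add: prod_sum_PiE)
  finally show ?thesis .
qed

lemma edge_prob_nonneg: "(\<And>e. e \<in> E \<Longrightarrow> 0 \<le> p e \<and> p e \<le> 1) \<Longrightarrow> A \<subseteq> E \<Longrightarrow> 0 \<le> edge_prob E p A"
  unfolding edge_prob_def by (intro mult_nonneg_nonneg prod_nonneg) auto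

lemma sum_edge_prob: "finite E \<Longrightarrow> (\<Sum>A\<in>Pow E. edge_prob E p A) = 1"
  unfolding edge_prob_def by (subst prod_add[symmetric]) auto

lemma edge_prob_UNION:
  assumes W: "finite W" "\<And>x. x \<in> W \<Longrightarrow> finite (E x)"
    and disj: "\<And>x y. x \<in> W \<Longrightarrow> y \<in> W \<Longrightarrow> x \<noteq> y \<Longrightarrow> E x \<inter> E y = {}"
    and A: "A \<subseteq> (\<Union>x\<in>W. E x)"
  shows "edge_prob (\<Union>x\<in>W. E x) p A = (\<Prod>x\<in>W. edge_prob (E x) p (A \<inter> E x))"
proof -
  have "A = (\<Union>x\<in>W. A \<inter> E x)" using A by auto
  then have "(\<Prod>e\<in>A. p e) = (\<Prod>e\<in>(\<Union>x\<in>W. A \<inter> E x). p e)" by simp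
  also have "\<dots> = (\<Prod>x\<in>W. \<Prod>e\<in>A \<inter> E x. p e)"
    using W disj by (intro prod.UNION_disjoint) fastforce+
  finally have 1: "(\<Prod>e\<in>A. p e) = (\<Prod>x\<in>W. \<Prod>e\<in>A \<inter> E x. p e)" .
  have "(\<Union>x\<in>W. E x) - A = (\<Union>x\<in>W. E x - A \<inter> E x)" by auto
  then have "(\<Prod>e\<in>(\<Union>x\<in>W. E x) - A. 1 - p e) = (\<Prod>e\<in>(\<Union>x\<in>W. E x - A \<inter> E x). 1 - p e)" by simp
  also have "\<dots> = (\<Prod>x\<in>W. \<Prod>e\<in>E x - A \<inter> E x. 1 - p e)"
    using W disj by (intro prod.UNION_disjoint) fastforce+
  finally show ?thesis using 1 by (simp add: edge_prob_def prod.distrib)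
qed

lemma edge_prob_mgf_le:
  assumes E: "finite E" "\<And>e. e \<in> E \<Longrightarrow> 0 \<le> p e \<and> p e \<le> 1" "\<And>e. e \<in> E \<Longrightarrow> \<bar>\<sigma> e\<bar> \<le> 1"
    and lam: "0 \<le> \<rho>" "\<rho> \<le> 1"
  shows "(\<Sum>B\<in>Pow E. edge_prob E p B * exp (\<rho> * (\<Sum>e\<in>E. \<sigma> e * (of_bool (e \<in> B) - p e))))
    \<le> exp (\<rho>\<^sup>2 * (\<Sum>e\<in>E. p e))"
proof -
  have c: "\<bar>\<rho> * \<sigma> e\<bar> \<le> 1 * 1" "(\<rho> * \<sigma> e)\<^sup>2 \<le> \<rho>\<^sup>2" if "e \<in> E" for e
  proof -
    show "\<bar>\<rho> * \<sigma> e\<bar> \<le> 1 * 1"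
      unfolding abs_mult using E(3)[OF that] lam by (intro mult_mono) auto
    have "(\<sigma> e)\<^sup>2 \<le> 1" using E(3)[OF that] by (simp add: abs_square_le_1)
    then show "(\<rho> * \<sigma> e)\<^sup>2 \<le> \<rho>\<^sup>2" by (simp add: power_mult_distrib mult_left_le)
  qed
  have split: "edge_prob E p B * exp (\<rho> * (\<Sum>e\<in>E. \<sigma> e * (of_bool (e \<in> B) - p e))) =
      (\<Prod>e\<in>B. p e * exp (\<rho> * \<sigma> e * (1 - p e))) * (\<Prod>e\<in>E - B. (1 - p e) * exp (- (\<rho> * \<sigma> e) * p e))"
    if "B \<in> Pow E" for B
  proof -
    have fin: "finite B" "B \<subseteq> E" using that E(1) finite_subset by auto
    have "exp (\<rho> * (\<Sum>e\<in>E. \<sigma> e * (of_bool (e \<in> B) - p e))) =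
        (\<Prod>e\<in>E. exp (\<rho> * \<sigma> e * (of_bool (e \<in> B) - p e)))"
      using E(1) by (simp add: sum_distrib_left exp_sum mult.assoc)
    also have "\<dots> = (\<Prod>e\<in>E - B. exp (\<rho> * \<sigma> e * (of_bool (e \<in> B) - p e))) *
        (\<Prod>e\<in>B. exp (\<rho> * \<sigma> e * (of_bool (e \<in> B) - p e)))"
      by (rule prod.subset_diff[OF fin(2) E(1)])
    finally show ?thesis by (simp add: edge_prob_def prod.distrib)
  qed
  have "(\<Sum>B\<in>Pow E. edge_prob E p B * exp (\<rho> * (\<Sum>e\<in>E. \<sigma> e * (of_bool (e \<in> B) - p e)))) =
      (\<Prod>e\<in>E. p e * exp (\<rho> * \<sigma> e * (1 - p e)) + (1 - p e) * exp (- (\<rho> * \<sigma> e) * p e))"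
    by (simp only: split prod_add[OF E(1)] cong: sum.cong)
  also have "\<dots> \<le> (\<Prod>e\<in>E. exp (\<rho>\<^sup>2 * p e))"
  proof (rule prod_mono)
    fix e assume e: "e \<in> E"
    have "p e * exp (\<rho> * \<sigma> e * (1 - p e)) + (1 - p e) * exp (- (\<rho> * \<sigma> e) * p e) \<le> exp ((\<rho> * \<sigma> e)\<^sup>2 * p e)"
      using E(2)[OF e] c[OF e] by (intro centered_bernoulli_mgf_le) auto
    also have "\<dots> \<le> exp (\<rho>\<^sup>2 * p e)" using c(2)[OF e] E(2)[OF e] by (simp add: mult_right_mono)
    finally show "0 \<le> p e * exp (\<rho> * \<sigma> e * (1 - p e)) + (1 - p e) * exp (- (\<rho> * \<sigma> e) * p e) \<and>
      p e * exp (\<rho> * \<sigma> e * (1 - p e)) + (1 - p e) * exp (- (\<rho> * \<sigma> e) * p e) \<le> exp (\<rho>\<^sup>2 * p e)"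
      using E(2)[OF e] by simp
  qed
  also have "\<dots> = exp (\<rho>\<^sup>2 * (\<Sum>e\<in>E. p e))" using E(1) by (simp add: exp_sum sum_distrib_left)
  finally show ?thesis .
qed

text \<open>The deviation argument sees the maximum entropy matrix only as edge probabilities with
  the right degrees whose product measure, times \<open>n ^ n\<close>, dominates the uniform
  one.\<close>

locale edge_model = bipartition V1 V2 for V1 V2 +
  fixes d :: "nat \<Rightarrow> nat" and p :: "nat set \<Rightarrow> real"
  assumes ne: "V1 \<noteq> {}" "V2 \<noteq> {}"
    and p_range: "\<And>e. e \<in> EE \<Longrightarrow> 0 \<le> p e \<and> p e \<le> 1"
    and p_out: "\<And>e. e \<notin> EE \<Longrightarrow> p e = 0"
    and p_degree: "\<And>v. v \<in> V \<Longrightarrow> (\<Sum>e\<in>{e \<in> EE. v \<in> e}. p e) = real (d v)"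
    and d_pos: "\<And>v. v \<in> V \<Longrightarrow> 0 < d v"
    and card_GG_pos: "card (constrained d V) > 0"
    and uniform_le: "\<And>A. A \<in> constrained d V \<Longrightarrow>
      1 / real (card (constrained d V)) \<le> real (card V) ^ card V * edge_prob EE p A"
begin

abbreviation "GG \<equiv> constrained d V"
abbreviation "n \<equiv> card V"
definition "M = (\<Sum>v\<in>V. real (d v))"
definition "EE_at x = {e \<in> EE. x \<in> e}"

definition avg :: "(nat set set \<Rightarrow> real) \<Rightarrow> real" where
  "avg F = (\<Sum>A\<in>GG. F A) / real (card GG)"

lemma finite_EE_at: "finite (EE_at x)" by (simp add: EE_at_def finite_EE)

lemma n_ge_2: "n \<ge> 2"
proof -
  have "card V = card V1 + card V2" using finV disjV by (simp add: card_Un_disjoint)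
  moreover have "card V1 > 0" "card V2 > 0" using ne finV by (auto simp: card_gt_0_iff)
  ultimately show ?thesis by linarith
qed

lemma avg_mono: "(\<And>A. A \<in> GG \<Longrightarrow> F A \<le> G A) \<Longrightarrow> avg F \<le> avg G"
  unfolding avg_def by (intro divide_right_mono sum_mono) auto

lemma avg_const: "avg (\<lambda>_. c) = c"
  using card_GG_pos by (simp add: avg_def)

lemma avg_sum: "avg (\<lambda>A. \<Sum>i\<in>I. F i A) = (\<Sum>i\<in>I. avg (F i))"
  unfolding avg_def by (subst sum.swap) (simp add: sum_divide_distrib)

lemma avg_cmult: "avg (\<lambda>A. c * F A) = c * avg F"
  by (simp add: avg_def sum_distrib_left)

lemma avg_diff: "avg (\<lambda>A. F A - G A) = avg F - avg G"
  by (simp add: avg_def sum_subtractf diff_divide_distrib)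

lemma avg_add: "avg (\<lambda>A. F A + G A) = avg F + avg G"
  by (simp add: avg_def sum.distrib add_divide_distrib)

text \<open>Jensen's inequality is obtained from the tangent of \<open>exp\<close> at
  \<open>avg F\<close>. After the domination, the sum may be extended to all graphs because its
  terms are nonnegative.\<close>

lemma avg_le_of_mgf:
  assumes "(\<Sum>A\<in>Pow EE. edge_prob EE p A * exp (F A)) \<le> exp b"
  shows "avg F \<le> b + real n * ln (real n)"
proof -
  have "exp (avg F) = avg (\<lambda>A. exp (avg F) * (1 + (F A - avg F)))"
    by (simp add: avg_cmult avg_add avg_diff avg_const)
  also have "\<dots> \<le> avg (\<lambda>A. exp (F A))"
  proof (rule avg_mono)
    fix A
    have "exp (avg F) * (1 + (F A - avg F)) \<le> exp (avg F) * exp (F A - avg F)"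
      using exp_ge_add_one_self[of "F A - avg F"] by (intro mult_left_mono) auto
    then show "exp (avg F) * (1 + (F A - avg F)) \<le> exp (F A)" by (simp flip: exp_add)
  qed
  also have "\<dots> = (\<Sum>A\<in>GG. 1 / real (card GG) * exp (F A))"
    by (simp add: avg_def sum_divide_distrib)
  also have "\<dots> \<le> (\<Sum>A\<in>GG. real n ^ n * edge_prob EE p A * exp (F A))"
    using uniform_le by (intro sum_mono mult_right_mono) auto
  also have "\<dots> \<le> (\<Sum>A\<in>Pow EE. real n ^ n * edge_prob EE p A * exp (F A))"
    by (rule sum_mono2) (use finite_EE p_range edge_prob_nonneg in \<open>auto simp: constrained_def\<close>)
  also have "\<dots> = real n ^ n * (\<Sum>A\<in>Pow EE. edge_prob EE p A * exp (F A))"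
    by (simp add: sum_distrib_left mult.assoc)
  also have "\<dots> \<le> real n ^ n * exp b" using assms by (intro mult_left_mono) auto
  also have "\<dots> = exp (b + real n * ln (real n))"
    using n_ge_2 by (simp add: exp_add exp_of_nat_mult)
  finally show ?thesis by simp
qed

section \<open>Maximal deviations at the vertices\<close>

lemma incident_partition:
  assumes "W = V1 \<or> W = V2"
  shows "(\<Union>x\<in>W. EE_at x) = EE" "x \<in> W \<Longrightarrow> y \<in> W \<Longrightarrow> x \<noteq> y \<Longrightarrow> EE_at x \<inter> EE_at y = {}"
  using assms disjV by (auto simp: EE_at_def bip_edges_def)

definition dev :: "(nat set \<Rightarrow> real) \<Rightarrow> nat \<Rightarrow> nat set set \<Rightarrow> real" where
  "dev \<sigma> x A = (\<Sum>e\<in>EE_at x. \<sigma> e * (of_bool (e \<in> A) - p e))"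

text \<open>The value 0 is included because the weights applied later sum to at most 1 and not to
  exactly 1; only a nonnegative maximum then dominates the weighted sum.\<close>

definition maxdev :: "'s set \<Rightarrow> ('s \<Rightarrow> nat \<Rightarrow> nat set \<Rightarrow> real) \<Rightarrow> nat \<Rightarrow> nat set set \<Rightarrow> real" where
  "maxdev J \<sigma> x A = Max (insert 0 ((\<lambda>s. dev (\<sigma> s x) x A) ` J))"

lemma dev_le_maxdev: "finite J \<Longrightarrow> s \<in> J \<Longrightarrow> dev (\<sigma> s x) x A \<le> maxdev J \<sigma> x A"
  unfolding maxdev_def by (rule Max_ge) auto

lemma maxdev_nonneg: "finite J \<Longrightarrow> 0 \<le> maxdev J \<sigma> x A"
  unfolding maxdev_def by (rule Max_ge) auto

lemma maxdev_cases:
  assumes "finite J"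
  shows "maxdev J \<sigma> x A = 0 \<or> (\<exists>s\<in>J. maxdev J \<sigma> x A = dev (\<sigma> s x) x A)"
  using Max_in[of "insert 0 ((\<lambda>s. dev (\<sigma> s x) x A) ` J)"] assms unfolding maxdev_def by auto

lemma maxdev_restrict: "maxdev J \<sigma> x A = maxdev J \<sigma> x (A \<inter> EE_at x)"
proof -
  have "dev \<tau> x A = dev \<tau> x (A \<inter> EE_at x)" for \<tau>
    unfolding dev_def by (intro sum.cong) auto
  then show ?thesis unfolding maxdev_def by simp
qed

lemma M_pos: "M > 0"
  unfolding M_def using finV ne d_pos by (intro sum_pos) auto

context
  fixes J :: "'s set" and \<sigma> :: "'s \<Rightarrow> nat \<Rightarrow> nat set \<Rightarrow> real"
  assumes J: "finite J" and \<sigma>: "\<And>s x e. \<bar>\<sigma> s x e\<bar> \<le> 1"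
begin

text \<open>The exponential of a maximum is at most the sum of the exponentials, and the included 0
  accounts for the summand 1.\<close>

lemma maxdev_mgf_le:
  assumes x: "x \<in> V" and lam: "0 \<le> \<rho>" "\<rho> \<le> 1"
  shows "(\<Sum>B\<in>Pow (EE_at x). edge_prob (EE_at x) p B * exp (\<rho> * maxdev J \<sigma> x B))
    \<le> exp (ln (1 + real (card J)) + \<rho>\<^sup>2 * real (d x))"
proof -
  have pr: "0 \<le> p e \<and> p e \<le> 1" if "e \<in> EE_at x" for e using that p_range by (auto simp: EE_at_def)
  have "exp (\<rho> * maxdev J \<sigma> x B) \<le> 1 + (\<Sum>s\<in>J. exp (\<rho> * dev (\<sigma> s x) x B))" for B
    using maxdev_cases[OF J, of \<sigma> x B]
  proof
    assume "\<exists>s\<in>J. maxdev J \<sigma> x B = dev (\<sigma> s x) x B"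
    then obtain s where "s \<in> J" "maxdev J \<sigma> x B = dev (\<sigma> s x) x B" by auto
    then show ?thesis using J by (auto intro!: add_increasing member_le_sum)
  qed (auto intro!: add_increasing2 sum_nonneg)
  then have "(\<Sum>B\<in>Pow (EE_at x). edge_prob (EE_at x) p B * exp (\<rho> * maxdev J \<sigma> x B)) \<le>
      (\<Sum>B\<in>Pow (EE_at x). edge_prob (EE_at x) p B * (1 + (\<Sum>s\<in>J. exp (\<rho> * dev (\<sigma> s x) x B))))"
    using edge_prob_nonneg[OF pr] by (intro sum_mono mult_left_mono) auto
  also have "\<dots> = 1 + (\<Sum>s\<in>J. \<Sum>B\<in>Pow (EE_at x). edge_prob (EE_at x) p B * exp (\<rho> * dev (\<sigma> s x) x B))"
    by (simp add: distrib_left sum.distrib sum_edge_prob[OF finite_EE_at] sum_distrib_left sum.swap[of _ J])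
  also have "\<dots> \<le> 1 + (\<Sum>s\<in>J. exp (\<rho>\<^sup>2 * (\<Sum>e\<in>EE_at x. p e)))"
    unfolding dev_def using pr \<sigma> lam finite_EE_at by (intro add_left_mono sum_mono edge_prob_mgf_le) auto
  also have "\<dots> = 1 + real (card J) * exp (\<rho>\<^sup>2 * real (d x))"
    using p_degree[OF x] by (simp add: EE_at_def)
  also have "\<dots> \<le> (1 + real (card J)) * exp (\<rho>\<^sup>2 * real (d x))"
    by (simp add: distrib_right)
  also have "\<dots> = exp (ln (1 + real (card J)) + \<rho>\<^sup>2 * real (d x))"
    by (simp add: exp_add add_pos_nonneg)
  finally show ?thesis .
qed

lemma avg_maxdev_side:
  assumes W: "W = V1 \<or> W = V2" and lam: "0 \<le> \<rho>" "\<rho> \<le> 1"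
  shows "\<rho> * (\<Sum>x\<in>W. avg (maxdev J \<sigma> x)) \<le>
    (\<Sum>x\<in>W. ln (1 + real (card J)) + \<rho>\<^sup>2 * real (d x)) + real n * ln (real n)"
proof -
  have finW: "finite W" "W \<subseteq> V" using W finV by auto
  note part = incident_partition[OF W]
  have pr: "0 \<le> p e \<and> p e \<le> 1" if "e \<in> EE_at x" for e x using that p_range by (auto simp: EE_at_def)
  have "(\<Sum>A\<in>Pow EE. edge_prob EE p A * exp (\<Sum>x\<in>W. \<rho> * maxdev J \<sigma> x A)) =
      (\<Sum>A\<in>Pow (\<Union>x\<in>W. EE_at x). \<Prod>x\<in>W. edge_prob (EE_at x) p (A \<inter> EE_at x) *
          exp (\<rho> * maxdev J \<sigma> x (A \<inter> EE_at x)))"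
    unfolding part(1)
  proof (rule sum.cong[OF refl])
    fix A assume "A \<in> Pow EE"
    then have "edge_prob EE p A = (\<Prod>x\<in>W. edge_prob (EE_at x) p (A \<inter> EE_at x))"
      using edge_prob_UNION[where E = EE_at, OF finW(1) finite_EE_at part(2), where A = A and p = p] part(1) by auto
    moreover have "exp (\<Sum>x\<in>W. \<rho> * maxdev J \<sigma> x A) = (\<Prod>x\<in>W. exp (\<rho> * maxdev J \<sigma> x (A \<inter> EE_at x)))"
      using finW by (simp add: exp_sum flip: maxdev_restrict)
    ultimately show "edge_prob EE p A * exp (\<Sum>x\<in>W. \<rho> * maxdev J \<sigma> x A) =
        (\<Prod>x\<in>W. edge_prob (EE_at x) p (A \<inter> EE_at x) * exp (\<rho> * maxdev J \<sigma> x (A \<inter> EE_at x)))"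
      by (simp add: prod.distrib)
  qed
  also have "\<dots> = (\<Prod>x\<in>W. \<Sum>B\<in>Pow (EE_at x). edge_prob (EE_at x) p B * exp (\<rho> * maxdev J \<sigma> x B))"
    by (rule sum_Pow_UNION[where E = EE_at, OF finW(1) finite_EE_at part(2)])
  also have "\<dots> \<le> (\<Prod>x\<in>W. exp (ln (1 + real (card J)) + \<rho>\<^sup>2 * real (d x)))"
    using maxdev_mgf_le[OF _ lam] finW edge_prob_nonneg[OF pr]
    by (intro prod_mono conjI sum_nonneg mult_nonneg_nonneg) auto
  also have "\<dots> = exp (\<Sum>x\<in>W. ln (1 + real (card J)) + \<rho>\<^sup>2 * real (d x))"
    using finW by (simp add: exp_sum)
  finally have "avg (\<lambda>A. \<Sum>x\<in>W. \<rho> * maxdev J \<sigma> x A) \<le>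
      (\<Sum>x\<in>W. ln (1 + real (card J)) + \<rho>\<^sup>2 * real (d x)) + real n * ln (real n)"
    by (rule avg_le_of_mgf)
  then show ?thesis by (simp add: avg_sum avg_cmult sum_distrib_left)
qed

text \<open>Origin of \<open>k + 3\<close>: each of the two sides pays \<open>n * ln n\<close> for
  the change of measure, and each of the \<open>n\<close> union bounds pays
  \<open>(k + 1) * ln n\<close>.\<close>

lemma avg_maxdev_le_lambda:
  assumes lam: "0 \<le> \<rho>" "\<rho> \<le> 1" and card: "card J \<le> n ^ k"
  shows "\<rho> * (\<Sum>x\<in>V. avg (maxdev J \<sigma> x)) \<le> (real k + 3) * (real n * ln (real n)) + \<rho>\<^sup>2 * M"
proof -
  have sumV: "(\<Sum>x\<in>V. f x) = (\<Sum>x\<in>V1. f x) + (\<Sum>x\<in>V2. f x)" for f :: "nat \<Rightarrow> real"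
    using finV disjV by (rule sum.union_disjoint)
  have "\<rho> * (\<Sum>x\<in>V. avg (maxdev J \<sigma> x)) \<le>
      (\<Sum>x\<in>V. ln (1 + real (card J)) + \<rho>\<^sup>2 * real (d x)) + 2 * (real n * ln (real n))"
    using avg_maxdev_side[OF _ lam, of V1] avg_maxdev_side[OF _ lam, of V2]
    by (simp add: sumV distrib_left)
  also have "(\<Sum>x\<in>V. ln (1 + real (card J)) + \<rho>\<^sup>2 * real (d x)) = real n * ln (1 + real (card J)) + \<rho>\<^sup>2 * M"
    by (simp add: sum.distrib M_def sum_distrib_left)
  finally have 1: "\<rho> * (\<Sum>x\<in>V. avg (maxdev J \<sigma> x)) \<le>
      real n * ln (1 + real (card J)) + \<rho>\<^sup>2 * M + 2 * (real n * ln (real n))" .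
  have "ln (1 + real (card J)) \<le> ln (real n ^ (k + 1))"
  proof (subst ln_le_cancel_iff)
    \<comment> \<open>One more factor \<open>n \<ge> 2\<close> absorbs the summand 1.\<close>
    have "1 + card J \<le> n ^ k + n ^ k" using card n_ge_2 by (intro add_mono) auto
    also have "\<dots> \<le> n * n ^ k" using mult_le_mono1[OF n_ge_2, of "n ^ k"] by (simp only: mult_2)
    finally have "real (1 + card J) \<le> real (n ^ (k + 1))" by (simp only: of_nat_le_iff Suc_eq_plus1[symmetric] power_Suc)
    then show "1 + real (card J) \<le> real n ^ (k + 1)" by simp
  qed (use n_ge_2 in auto)
  also have "ln (real n ^ (k + 1)) = (real k + 1) * ln (real n)"
    using n_ge_2 by (subst ln_realpow) auto
  finally have "real n * ln (1 + real (card J)) \<le> real n * ((real k + 1) * ln (real n))"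
    by (rule mult_left_mono) simp
  with 1 show ?thesis by (simp add: algebra_simps)
qed

text \<open>Serves the sparse case \<open>M < n * ln n\<close>, where the best exponential parameter
  would exceed 1. At \<open>x\<close> both the edges of the graph and the probabilities add up to
  \<open>d x\<close>.\<close>

lemma avg_maxdev_le_trivial: "(\<Sum>x\<in>V. avg (maxdev J \<sigma> x)) \<le> 2 * M"
proof -
  have "maxdev J \<sigma> x A \<le> 2 * real (d x)" if "x \<in> V" "A \<in> GG" for x A
  proof -
    have "dev (\<sigma> s x) x A \<le> 2 * real (d x)" for s
    proof -
      have "dev (\<sigma> s x) x A \<le> (\<Sum>e\<in>EE_at x. of_bool (e \<in> A) + p e)"
        unfolding dev_def
      proof (rule sum_mono)
        fix e assume "e \<in> EE_at x"
        then have "0 \<le> p e" using p_range by (auto simp: EE_at_def)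
        have "\<sigma> s x e * (of_bool (e \<in> A) - p e) \<le> \<bar>\<sigma> s x e\<bar> * \<bar>of_bool (e \<in> A) - p e\<bar>"
          by (simp flip: abs_mult)
        also have "\<dots> \<le> 1 * (of_bool (e \<in> A) + p e)"
          using \<sigma> \<open>0 \<le> p e\<close> by (intro mult_mono) auto
        finally show "\<sigma> s x e * (of_bool (e \<in> A) - p e) \<le> of_bool (e \<in> A) + p e" by simp
      qed
      also have "\<dots> = real (vertex_degree A x) + real (d x)"
      proof -
        have "EE_at x \<inter> {e. e \<in> A} = {e \<in> A. x \<in> e}" using \<open>A \<in> GG\<close> by (auto simp: EE_at_def constrained_def)
        then show ?thesis
          using p_degree[OF \<open>x \<in> V\<close>] by (simp add: sum.distrib finite_EE_at vertex_degree_def flip: EE_at_def)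
      qed
      finally show ?thesis using that by (simp add: constrained_def)
    qed
    then show ?thesis using maxdev_cases[OF J, of \<sigma> x A] by auto
  qed
  then have "avg (maxdev J \<sigma> x) \<le> 2 * real (d x)" if "x \<in> V" for x
    using avg_mono[of "maxdev J \<sigma> x" "\<lambda>_. 2 * real (d x)"] that by (simp add: avg_const)
  then show ?thesis unfolding M_def sum_distrib_left by (rule sum_mono)
qed

lemma avg_maxdev_le:
  assumes "card J \<le> n ^ k"
  shows "(\<Sum>x\<in>V. avg (maxdev J \<sigma> x)) \<le> (real k + 4) * sqrt (M * (real n * ln (real n)))"
proof -
  define L where "L = real n * ln (real n)"
  have L: "L > 0" unfolding L_def using n_ge_2 by auto
  show ?thesis
  proof (cases "L \<le> M")
    case True
    \<comment> \<open>This value balances \<open>L / \<rho>\<close> against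
      \<open>\<rho> * M\<close>: both become \<open>sqrt (M * L)\<close>, and \<open>k + 3\<close>
      turns into \<open>k + 4\<close>.\<close>
    define \<rho> where "\<rho> = sqrt (L / M)"
    have lam: "0 < \<rho>" "\<rho> \<le> 1" using True L M_pos by (auto simp: \<rho>_def)
    have LM: "L = \<rho> * sqrt (M * L)" "\<rho>\<^sup>2 * M = \<rho> * sqrt (M * L)"
    proof -
      have "\<rho> * sqrt (M * L) = sqrt (L * L)"
        unfolding \<rho>_def using M_pos by (simp flip: real_sqrt_mult)
      then show "L = \<rho> * sqrt (M * L)" using L by simp
      then show "\<rho>\<^sup>2 * M = \<rho> * sqrt (M * L)" using M_pos L by (simp add: \<rho>_def)
    qed
    have "\<rho> * (\<Sum>x\<in>V. avg (maxdev J \<sigma> x)) \<le> (real k + 3) * L + \<rho>\<^sup>2 * M"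
      unfolding L_def using lam assms by (intro avg_maxdev_le_lambda) auto
    also have "\<dots> = (real k + 3) * (\<rho> * sqrt (M * L)) + \<rho> * sqrt (M * L)"
      by (simp only: LM(2) flip: LM(1))
    also have "\<dots> = \<rho> * ((real k + 4) * sqrt (M * L))"
      by (simp add: algebra_simps)
    finally show ?thesis using lam by (simp add: L_def)
  next
    case False
    have "M = sqrt (M * M)" using M_pos by simp
    also have "\<dots> \<le> sqrt (M * L)" using False M_pos by (intro real_sqrt_le_mono mult_left_mono) auto
    finally have "2 * M \<le> 2 * sqrt (M * L)" by simp
    also have "\<dots> \<le> (real k + 4) * sqrt (M * L)" using M_pos L by (intro mult_right_mono) auto
    finally show ?thesis using avg_maxdev_le_trivial by (simp add: L_def)
  qed
qed

end

text \<open>The signs of the averages turn absolute values of averages into averages. They are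
  constant in \<open>A\<close>, so for each graph the weighted deviations at \<open>x\<close> are at
  most the maximum over \<open>J\<close>, however the weights vary with the graph.\<close>

theorem weighted_edge_deviation:
  fixes w :: "'s \<Rightarrow> nat \<Rightarrow> nat set set \<Rightarrow> real"
  assumes J: "finite J" "card J \<le> n ^ k"
    and w: "\<And>s x A. 0 \<le> w s x A" "\<And>x A. x \<in> V \<Longrightarrow> A \<in> GG \<Longrightarrow> (\<Sum>s\<in>J. w s x A) \<le> 1"
  shows "(\<Sum>x\<in>V. \<Sum>s\<in>J. \<Sum>e\<in>EE_at x. \<bar>avg (\<lambda>A. w s x A * (of_bool (e \<in> A) - p e))\<bar>)
    \<le> (real k + 4) * sqrt (M * (real n * ln (real n)))"
proof -
  define \<sigma> where "\<sigma> s x e = sgn (avg (\<lambda>A. w s x A * (of_bool (e \<in> A) - p e)))" for s x e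
  have \<sigma>: "\<bar>\<sigma> s x e\<bar> \<le> 1" for s x e by (simp add: \<sigma>_def sgn_if)
  have "(\<Sum>x\<in>V. \<Sum>s\<in>J. \<Sum>e\<in>EE_at x. \<bar>avg (\<lambda>A. w s x A * (of_bool (e \<in> A) - p e))\<bar>) =
      (\<Sum>x\<in>V. avg (\<lambda>A. \<Sum>s\<in>J. w s x A * dev (\<sigma> s x) x A))"
  proof (rule sum.cong[OF refl])
    fix x
    have "\<bar>avg (\<lambda>A. w s x A * (of_bool (e \<in> A) - p e))\<bar> =
        avg (\<lambda>A. \<sigma> s x e * (w s x A * (of_bool (e \<in> A) - p e)))" for s e
      by (simp only: avg_cmult) (simp add: \<sigma>_def abs_sgn mult.commute)
    then show "(\<Sum>s\<in>J. \<Sum>e\<in>EE_at x. \<bar>avg (\<lambda>A. w s x A * (of_bool (e \<in> A) - p e))\<bar>) =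
        avg (\<lambda>A. \<Sum>s\<in>J. w s x A * dev (\<sigma> s x) x A)"
      by (simp add: dev_def sum_distrib_left avg_sum mult.left_commute)
  qed
  also have "\<dots> \<le> (\<Sum>x\<in>V. avg (maxdev J \<sigma> x))"
  proof (intro sum_mono avg_mono)
    fix x A assume x: "x \<in> V" "A \<in> GG"
    have "(\<Sum>s\<in>J. w s x A * dev (\<sigma> s x) x A) \<le> (\<Sum>s\<in>J. w s x A * maxdev J \<sigma> x A)"
      using w(1) J by (intro sum_mono mult_left_mono dev_le_maxdev) auto
    also have "\<dots> = (\<Sum>s\<in>J. w s x A) * maxdev J \<sigma> x A" by (simp add: sum_distrib_right)
    also have "\<dots> \<le> 1 * maxdev J \<sigma> x A" using w(2)[OF x] maxdev_nonneg[OF J(1)] by (intro mult_right_mono) auto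
    finally show "(\<Sum>s\<in>J. w s x A * dev (\<sigma> s x) x A) \<le> maxdev J \<sigma> x A" by simp
  qed
  also have "\<dots> \<le> (real k + 4) * sqrt (M * (real n * ln (real n)))"
    by (rule avg_maxdev_le[OF J(1) \<sigma> J(2)])
  finally show ?thesis .
qed

end

section \<open>Trees\<close>

text \<open>Leaves are attached in the order in which tree edges are later replaced by
  probabilities, so rule induction takes the place of choosing and deleting a leaf.\<close>

inductive grown_tree :: "nat set \<Rightarrow> nat set set \<Rightarrow> bool" where
  root: "grown_tree {r} {}"
| leaf: "grown_tree S T \<Longrightarrow> u \<in> S \<Longrightarrow> w \<notin> S \<Longrightarrow> grown_tree (insert w S) (insert {u, w} T)"

lemma grown_tree_edges: "grown_tree S T \<Longrightarrow> e \<in> T \<Longrightarrow> e \<subseteq> S"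
  by (induction rule: grown_tree.induct) auto

lemma grown_tree_finite: "grown_tree S T \<Longrightarrow> finite S \<and> finite T \<and> S \<noteq> {}"
  by (induction rule: grown_tree.induct) auto

text \<open>Supplies the path that an additional edge would close to a cycle.\<close>

lemma grown_tree_path:
  assumes "grown_tree S T" "a \<in> S" "b \<in> S"
  shows "\<exists>c. c \<noteq> [] \<and> distinct c \<and> set c \<subseteq> S \<and> hd c = a \<and> last c = b \<and>
    successively (\<lambda>x y. {x, y} \<in> T) c"
  using assms
proof (induction arbitrary: a b rule: grown_tree.induct)
  case (root r)
  then show ?case by (intro exI[of _ "[r]"]) auto
next
  case (leaf S T u w)
  have mono: "successively (\<lambda>x y. {x, y} \<in> insert {u, w} T) c" if "successively (\<lambda>x y. {x, y} \<in> T) c" for c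
    using that by (rule successively_mono) auto
  consider "a \<in> S" "b \<in> S" | "a \<in> S" "b = w" | "a = w" "b \<in> S" | "a = w" "b = w"
    using leaf.prems by auto
  then show ?case
  proof cases
    case 1
    then obtain c where "c \<noteq> []" "distinct c" "set c \<subseteq> S" "hd c = a" "last c = b"
      "successively (\<lambda>x y. {x, y} \<in> T) c" using leaf.IH by blast
    then show ?thesis using mono by (intro exI[of _ c]) auto
  next
    case 2
    then obtain c where "c \<noteq> []" "distinct c" "set c \<subseteq> S" "hd c = a" "last c = u"
      "successively (\<lambda>x y. {x, y} \<in> T) c" using leaf.IH leaf.hyps by blast
    then show ?thesis using mono 2 leaf.hyps
      by (intro exI[of _ "c @ [w]"]) (auto simp: successively_append_iff)
  next
    case 3
    then obtain c where "c \<noteq> []" "distinct c" "set c \<subseteq> S" "hd c = u" "last c = b"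
      "successively (\<lambda>x y. {x, y} \<in> T) c" using leaf.IH leaf.hyps by blast
    then show ?thesis using mono 3 leaf.hyps
      by (intro exI[of _ "w # c"]) (auto simp: successively_Cons insert_commute)
  next
    case 4
    then show ?thesis by (intro exI[of _ "[w]"]) auto
  qed
qed

lemma rtrancl_crossing:
  assumes "(a, z) \<in> R\<^sup>*" "a \<in> S" "z \<notin> S"
  shows "\<exists>b c. (b, c) \<in> R \<and> b \<in> S \<and> c \<notin> S"
  using assms by (induction rule: rtrancl_induct) blast+

text \<open>A subtree of \<open>T\<close> that does not span can be enlarged, because connectivity
  gives an edge leaving it. An edge of \<open>T\<close> missing from the spanning subtree would
  close a cycle.\<close>

lemma labeled_tree_grown:
  assumes T: "T \<in> labeled_trees k" and "k \<ge> 1"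
  shows "grown_tree {1..k} T"
proof -
  have sg: "simple_graph {1..k} T" and conn: "graph_connected {1..k} T" and acyc: "\<And>c. \<not> is_cycle T c"
    using T by (auto simp: labeled_trees_def)
  have "\<exists>S T'. card S = m \<and> S \<subseteq> {1..k} \<and> T' \<subseteq> T \<and> grown_tree S T'" if "1 \<le> m" "m \<le> k" for m
    using that
  proof (induction m rule: nat_induct_at_least)
    case base
    then show ?case using root[of 1] by (intro exI[of _ "{1}"] exI[of _ "{}"]) auto
  next
    case (Suc m)
    then obtain S T' where S: "card S = m" "S \<subseteq> {1..k}" "T' \<subseteq> T" "grown_tree S T'" by auto
    obtain z where z: "z \<in> {1..k}" "z \<notin> S"
    proof -
      have "S \<noteq> {1..k}" using S(1) Suc.prems by auto
      then show ?thesis using S(2) that by blast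
    qed
    obtain a where "a \<in> S" using grown_tree_finite[OF S(4)] by auto
    then have "(a, z) \<in> {(a, b). {a, b} \<in> T}\<^sup>*" using conn z S(2) by (auto simp: graph_connected_def)
    then obtain b c where bc: "{b, c} \<in> T" "b \<in> S" "c \<notin> S"
      using rtrancl_crossing[OF _ \<open>a \<in> S\<close> z(2)] by blast
    then have "c \<in> {1..k}" using sg by (auto simp: simple_graph_def doubleton_eq_iff)
    moreover have "card (insert c S) = Suc m" using S(1) bc grown_tree_finite[OF S(4)] by simp
    ultimately show ?case using S bc leaf[OF S(4) bc(2,3)]
      by (intro exI[of _ "insert c S"] exI[of _ "insert {b, c} T'"]) auto
  qed
  from this[of k] obtain S T' where S: "card S = k" "S \<subseteq> {1..k}" "T' \<subseteq> T" "grown_tree S T'"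
    using assms by auto
  then have Sk: "S = {1..k}" by (intro card_subset_eq) auto
  have "T \<subseteq> T'"
  proof (rule ccontr)
    assume "\<not> T \<subseteq> T'"
    then obtain e where "e \<in> T" "e \<notin> T'" by auto
    then obtain a b where ab: "{a, b} \<in> T" "{a, b} \<notin> T'" "a \<in> S" "b \<in> S" "a \<noteq> b"
      using sg Sk by (auto simp: simple_graph_def)
    obtain c where c: "c \<noteq> []" "distinct c" "hd c = a" "last c = b"
      "successively (\<lambda>x y. {x, y} \<in> T') c" using grown_tree_path[OF S(4) ab(3,4)] by auto
    have edge: "{c ! i, c ! Suc i} \<in> T'" if "Suc i < length c" for i
      using c(5) that by (auto simp: successively_conv_nth)
    have ends: "c ! 0 = a" "c ! (length c - 1) = b" using c by (auto simp: hd_conv_nth last_conv_nth)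
    \<comment> \<open>A path with one vertex has equal ends, and one with two vertices would make
      \<open>{a, b}\<close> an edge of \<open>T'\<close>; \<open>is_cycle\<close> asks for three
      vertices.\<close>
    have "length c \<noteq> 1" using ends ab(5) by auto
    moreover have "length c \<noteq> 2" using edge[of 0] ends ab(2) by auto
    moreover have "length c \<noteq> 0" using c(1) by simp
    ultimately have "length c \<ge> 3" by linarith
    moreover have "{c ! i, c ! (Suc i mod length c)} \<in> T" if "i < length c" for i
    proof (cases "Suc i = length c")
      case True
      then have "i = length c - 1" by simp
      then show ?thesis using True ends ab(1) by (simp add: insert_commute)
    next
      case False
      then show ?thesis using edge[of i] that S(3) by auto
    qed
    ultimately have "is_cycle T c" using c(2) by (simp add: is_cycle_def)
    then show False using acyc by simp
  qed
  then show ?thesis using S Sk by auto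
qed

text \<open>With the indicator of a graph as \<open>c\<close> this tells whether \<open>s\<close>
  embeds \<open>T\<close>; with edge probabilities and injective \<open>s\<close> it is the
  probability of this for independent edges.\<close>

definition tree_prod :: "(nat set \<Rightarrow> real) \<Rightarrow> nat set set \<Rightarrow> (nat \<Rightarrow> nat) \<Rightarrow> real" where
  "tree_prod c T s = (\<Prod>e\<in>T. c (s ` e))"

lemma tree_prod_nonneg: "(\<And>e. 0 \<le> c e) \<Longrightarrow> 0 \<le> tree_prod c T s"
  unfolding tree_prod_def by (rule prod_nonneg) auto

lemma tree_prod_leaf:
  assumes "grown_tree S T" "u \<in> S" "w \<notin> S"
  shows "tree_prod c (insert {u, w} T) (s(w := y)) = tree_prod c T s * c {s u, y}"
proof -
  have "{u, w} \<notin> T" "finite T" using grown_tree_edges[OF assms(1)] grown_tree_finite[OF assms(1)] assms(3) by auto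
  then have "tree_prod c (insert {u, w} T) (s(w := y)) =
      c ((s(w := y)) ` {u, w}) * (\<Prod>e\<in>T. c ((s(w := y)) ` e))"
    by (simp add: tree_prod_def del: image_insert)
  also have "(s(w := y)) ` {u, w} = {s u, y}" using assms by auto
  also have "(\<Prod>e\<in>T. c ((s(w := y)) ` e)) = tree_prod c T s"
    unfolding tree_prod_def
  proof (rule prod.cong[OF refl])
    fix e assume "e \<in> T"
    then have "w \<notin> e" using grown_tree_edges[OF assms(1)] assms(3) by auto
    then have "(s(w := y)) ` e = s ` e" by (intro image_cong) auto
    then show "c ((s(w := y)) ` e) = c (s ` e)" by (simp only:)
  qed
  finally show ?thesis by (simp only: mult.commute)
qed

definition inj_maps :: "nat set \<Rightarrow> nat set \<Rightarrow> (nat \<Rightarrow> nat) set" where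
  "inj_maps S V = {s \<in> S \<rightarrow>\<^sub>E V. inj_on s S}"

lemma inj_maps_finite_card:
  assumes "finite S" "finite V"
  shows "finite (inj_maps S V)" "card (inj_maps S V) \<le> card V ^ card S"
proof -
  have fin: "finite (S \<rightarrow>\<^sub>E V)" using assms by (intro finite_PiE) auto
  then show "finite (inj_maps S V)" unfolding inj_maps_def by auto
  have "card (inj_maps S V) \<le> card (S \<rightarrow>\<^sub>E V)" unfolding inj_maps_def by (rule card_mono[OF fin]) auto
  then show "card (inj_maps S V) \<le> card V ^ card S" using assms by (simp add: card_PiE)
qed

lemma sum_inj_maps_insert:
  fixes g :: "(nat \<Rightarrow> nat) \<Rightarrow> real"
  assumes "finite S" "finite V" "w \<notin> S"
  shows "(\<Sum>s\<in>inj_maps (insert w S) V. g s) = (\<Sum>s\<in>inj_maps S V. \<Sum>y\<in>V - s ` S. g (s(w := y)))"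
proof -
  have fin: "finite (inj_maps S V)" using assms inj_maps_finite_card by auto
  have "bij_betw (\<lambda>(s, y). s(w := y)) (SIGMA s:inj_maps S V. V - s ` S) (inj_maps (insert w S) V)"
  proof (rule bij_betw_byWitness[where f' = "\<lambda>s. (s(w := undefined), s w)"])
    show "\<forall>sy\<in>SIGMA s:inj_maps S V. V - s ` S.
        (\<lambda>s. (s(w := undefined), s w)) ((\<lambda>(s, y). s(w := y)) sy) = sy"
      using assms(3) by (auto simp: inj_maps_def PiE_iff extensional_def fun_eq_iff)
    have upd: "(s(w := y)) ` S = s ` S" "inj_on (s(w := y)) S \<longleftrightarrow> inj_on s S" for s :: "nat \<Rightarrow> nat" and y
      using assms(3) by (auto intro!: image_cong inj_on_cong)
    show "(\<lambda>(s, y). s(w := y)) ` (SIGMA s:inj_maps S V. V - s ` S) \<subseteq> inj_maps (insert w S) V"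
    proof clarify
      fix s y assume "s \<in> inj_maps S V" "y \<in> V" "y \<notin> s ` S"
      then show "s(w := y) \<in> inj_maps (insert w S) V"
        using assms(3) upd[of s y] by (auto simp: inj_maps_def PiE_iff extensional_def simp del: fun_upd_image)
    qed
    show "(\<lambda>s. (s(w := undefined), s w)) ` inj_maps (insert w S) V \<subseteq> (SIGMA s:inj_maps S V. V - s ` S)"
    proof clarify
      fix s assume "s \<in> inj_maps (insert w S) V"
      then show "s(w := undefined) \<in> inj_maps S V \<and> s w \<in> V - s(w := undefined) ` S"
        using assms(3) upd[of s undefined]
        by (auto simp: inj_maps_def PiE_iff extensional_def simp del: fun_upd_image)
    qed
  qed auto
  from sum.reindex_bij_betw[OF this, of g] show ?thesis
    using fin assms(2) by (simp add: sum.Sigma case_prod_unfold)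
qed

section \<open>Growing a tree by one leaf\<close>

context edge_model
begin

definition psi :: "nat set \<Rightarrow> nat set set \<Rightarrow> (nat \<Rightarrow> nat) \<Rightarrow> real" where
  "psi S T s = (\<Prod>u\<in>S. real (d (s u)) powi (int (vertex_degree T u) - 1))"

lemma psi_nonneg: "0 \<le> psi S T s"
  unfolding psi_def by (intro prod_nonneg ballI zero_le_power_int) auto

text \<open>The new leaf has exponent 0 and the exponent of \<open>u\<close> rises by one. It can
  start at -1, for a single vertex, and the step to 0 needs a nonzero base.\<close>

lemma psi_leaf:
  assumes T: "grown_tree S T" "u \<in> S" "w \<notin> S" and s: "s u \<in> V"
  shows "psi (insert w S) (insert {u, w} T) (s(w := y)) = psi S T s * real (d (s u))"
proof -
  have fin: "finite S" "finite T" using grown_tree_finite[OF T(1)] by auto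
  have new: "{u, w} \<notin> T" using grown_tree_edges[OF T(1)] T(3) by auto
  have deg: "vertex_degree (insert {u, w} T) v = (if v \<in> {u, w} then 1 else 0) + vertex_degree T v" for v
  proof -
    have "{e \<in> insert {u, w} T. v \<in> e} = (if v \<in> {u, w} then {{u, w}} else {}) \<union> {e \<in> T. v \<in> e}" by auto
    moreover have "card ((if v \<in> {u, w} then {{u, w}} else {}) \<union> {e \<in> T. v \<in> e}) =
        (if v \<in> {u, w} then 1 else 0) + card {e \<in> T. v \<in> e}"
      using fin new by (subst card_Un_disjoint) auto
    ultimately show ?thesis by (simp add: vertex_degree_def)
  qed
  then have degS: "vertex_degree (insert {u, w} T) v = (if v = u then 1 else 0) + vertex_degree T v" if "v \<in> S" for v
    using that T(3) by auto
  have "{e \<in> T. w \<in> e} = {}" using grown_tree_edges[OF T(1)] T(3) by auto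
  then have w0: "vertex_degree T w = 0" unfolding vertex_degree_def by (simp only: card.empty)
  have "psi (insert w S) (insert {u, w} T) (s(w := y)) =
      (\<Prod>v\<in>S. real (d (s v)) powi (int (vertex_degree (insert {u, w} T) v) - 1))"
    using fin T by (auto simp: psi_def deg w0 intro!: prod.cong)
  also have "\<dots> = real (d (s u)) powi (int (vertex_degree T u) - 1 + 1) *
      (\<Prod>v\<in>S - {u}. real (d (s v)) powi (int (vertex_degree T v) - 1))"
    using T(2) by (subst prod.remove[OF fin(1) T(2)]) (auto simp: degS intro!: arg_cong2[where f = "(*)"] prod.cong)
  also have "\<dots> = psi S T s * real (d (s u))"
  proof -
    have "real (d (s u)) powi (int (vertex_degree T u) - 1 + 1) =
        real (d (s u)) powi (int (vertex_degree T u) - 1) * real (d (s u))"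
      using d_pos[OF s] by (intro power_int_add_1) simp
    then show ?thesis unfolding psi_def prod.remove[OF fin(1) T(2)] by (simp only: mult_ac)
  qed
  finally show ?thesis .
qed

lemma sum_neighbours:
  fixes g :: "nat set \<Rightarrow> real"
  assumes x: "x \<in> V" and g: "\<And>e. e \<notin> EE \<Longrightarrow> g e = 0"
  shows "(\<Sum>y\<in>V. g {x, y}) = (\<Sum>e\<in>EE_at x. g e)"
proof -
  have "(\<Sum>y\<in>V. g {x, y}) = (\<Sum>y\<in>{y \<in> V. {x, y} \<in> EE}. g {x, y})"
    using finV g by (intro sum.mono_neutral_right) auto
  also have "\<dots> = (\<Sum>e\<in>EE_at x. g e)"
  proof (rule sum.reindex_bij_betw, rule bij_betw_imageI)
    show "inj_on (\<lambda>y. {x, y}) {y \<in> V. {x, y} \<in> EE}" by (auto simp: inj_on_def doubleton_eq_iff)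
    show "(\<lambda>y. {x, y}) ` {y \<in> V. {x, y} \<in> EE} = EE_at x"
    proof
      show "EE_at x \<subseteq> (\<lambda>y. {x, y}) ` {y \<in> V. {x, y} \<in> EE}"
      proof
        fix e assume "e \<in> EE_at x"
        then have e: "e \<in> EE" "x \<in> e" by (auto simp: EE_at_def)
        then obtain a b where ab: "e = {a, b}" "a \<in> V1" "b \<in> V2" by (auto simp: bip_edges_def)
        then have "e = {x, if x = a then b else a}" "(if x = a then b else a) \<in> V" using e by auto
        then show "e \<in> (\<lambda>y. {x, y}) ` {y \<in> V. {x, y} \<in> EE}" using e(1) by blast
      qed
    qed (auto simp: EE_at_def)
  qed
  finally show ?thesis .
qed

abbreviation ind :: "nat set set \<Rightarrow> nat set \<Rightarrow> real" where
  "ind A e \<equiv> of_bool (e \<in> A)"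

lemma sum_ind:
  assumes "A \<in> GG" "x \<in> V"
  shows "(\<Sum>y\<in>V. ind A {x, y}) = real (d x)"
proof -
  have "(\<Sum>y\<in>V. ind A {x, y}) = (\<Sum>e\<in>EE_at x. ind A e)"
    using assms by (intro sum_neighbours) (auto simp: constrained_def)
  also have "\<dots> = real (card (EE_at x \<inter> {e. e \<in> A}))" by (simp add: finite_EE_at)
  also have "EE_at x \<inter> {e. e \<in> A} = {e \<in> A. x \<in> e}" using assms by (auto simp: EE_at_def constrained_def)
  finally show ?thesis using assms by (simp add: constrained_def vertex_degree_def)
qed

lemma sum_p: "x \<in> V \<Longrightarrow> (\<Sum>y\<in>V. p {x, y}) = real (d x)"
  using p_degree[of x] p_out by (simp add: sum_neighbours EE_at_def)

lemma p_nonneg: "0 \<le> p e"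
  using p_range[of e] p_out[of e] by (cases "e \<in> EE") auto

abbreviation "IM S \<equiv> inj_maps S V"

lemma IM_in: "s \<in> IM S \<Longrightarrow> u \<in> S \<Longrightarrow> s u \<in> V"
  by (auto simp: inj_maps_def)

lemma sum_leaf:
  assumes T: "grown_tree S T" "u \<in> S" "w \<notin> S"
  shows "(\<Sum>s\<in>IM (insert w S). F s / psi (insert w S) (insert {u, w} T) s) =
    (\<Sum>s\<in>IM S. \<Sum>y\<in>V - s ` S. F (s(w := y)) / (psi S T s * real (d (s u))))"
  using grown_tree_finite[OF T(1)] finV T IM_in
  by (subst sum_inj_maps_insert) (auto intro!: sum.cong simp: psi_leaf)

text \<open>The embeddings of a tree in a graph with prescribed root image, weighted by \<open>1 / psi\<close>, are dominated by
  the random homomorphism that sends each child to a uniform neighbour of the image of its parent.\<close>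

lemma rooted_weight_le:
  assumes "grown_tree S T" "r \<in> S" "x \<in> V" "A \<in> GG"
  shows "(\<Sum>s\<in>IM S. (of_bool (s r = x) * tree_prod (ind A) T s) / psi S T s) \<le> real (d x)"
  using assms(1,2,3)
proof (induction arbitrary: r x rule: grown_tree.induct)
  case (root r0)
  have fin: "finite (IM {r0})" using finV by (simp add: inj_maps_finite_card)
  \<comment> \<open>For a single vertex the exponent in \<open>psi\<close> is -1, so the only map
    with root image \<open>x\<close> has weight \<open>d x\<close>.\<close>
  have "(\<Sum>s\<in>IM {r0}. of_bool (s r = x) * tree_prod (ind A) {} s / psi {r0} {} s) =
      (\<Sum>s\<in>IM {r0}. if s r = x then real (d x) else 0)"
    using root by (intro sum.cong)
      (auto simp: tree_prod_def psi_def vertex_degree_def power_int_minus divide_inverse)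
  also have "\<dots> = real (card {s \<in> IM {r0}. s r = x}) * real (d x)"
    by (simp only: sum.inter_filter[OF fin, symmetric]) simp
  also have "\<dots> \<le> 1 * real (d x)"
  proof (rule mult_right_mono)
    have "s = restrict (\<lambda>_. x) {r0}" if "s \<in> IM {r0}" "s r = x" for s
      using that root by (auto simp: inj_maps_def PiE_iff extensional_def fun_eq_iff)
    then have "{s \<in> IM {r0}. s r = x} \<subseteq> {restrict (\<lambda>_. x) {r0}}" by blast
    from card_mono[OF _ this] show "real (card {s \<in> IM {r0}. s r = x}) \<le> 1" by simp
  qed simp
  finally show ?case by simp
next
  case (leaf S T u w)
  define g where "g s = tree_prod (ind A) T s / psi S T s" for s
  have g: "0 \<le> g s" for s unfolding g_def by (intro divide_nonneg_nonneg tree_prod_nonneg psi_nonneg) simp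
  have eq: "(\<Sum>s\<in>IM (insert w S). (of_bool (s r = x) * tree_prod (ind A) (insert {u, w} T) s) /
        psi (insert w S) (insert {u, w} T) s) =
      (\<Sum>s\<in>IM S. \<Sum>y\<in>V - s ` S. of_bool ((s(w := y)) r = x) * (g s * (ind A {s u, y} / real (d (s u)))))"
    unfolding sum_leaf[OF leaf.hyps] tree_prod_leaf[OF leaf.hyps] g_def by (intro sum.cong) auto
  show ?case
  proof (cases "r = w")
    case False
    then have r: "r \<in> S" using leaf.prems by auto
    have "(\<Sum>s\<in>IM S. \<Sum>y\<in>V - s ` S. of_bool ((s(w := y)) r = x) * (g s * (ind A {s u, y} / real (d (s u))))) \<le>
        (\<Sum>s\<in>IM S. \<Sum>y\<in>V. of_bool (s r = x) * g s * (ind A {s u, y} / real (d (s u))))"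
    proof (rule sum_mono)
      fix s
      have "(\<Sum>y\<in>V - s ` S. of_bool ((s(w := y)) r = x) * (g s * (ind A {s u, y} / real (d (s u))))) =
          (\<Sum>y\<in>V - s ` S. of_bool (s r = x) * g s * (ind A {s u, y} / real (d (s u))))"
        using False by (simp add: mult.assoc)
      also have "\<dots> \<le> (\<Sum>y\<in>V. of_bool (s r = x) * g s * (ind A {s u, y} / real (d (s u))))"
        using finV g by (intro sum_mono2) auto
      finally show "(\<Sum>y\<in>V - s ` S. of_bool ((s(w := y)) r = x) * (g s * (ind A {s u, y} / real (d (s u))))) \<le>
          (\<Sum>y\<in>V. of_bool (s r = x) * g s * (ind A {s u, y} / real (d (s u))))" .
    qed
    also have "\<dots> = (\<Sum>s\<in>IM S. of_bool (s r = x) * g s)"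
    proof (rule sum.cong[OF refl])
      fix s assume "s \<in> IM S"
      then have su: "s u \<in> V" using IM_in leaf.hyps by auto
      show "(\<Sum>y\<in>V. of_bool (s r = x) * g s * (ind A {s u, y} / real (d (s u)))) = of_bool (s r = x) * g s"
        using sum_ind[OF assms(4) su] d_pos[OF su]
        by (simp only: sum_distrib_left[symmetric] sum_divide_distrib[symmetric]) simp
    qed
    also have "\<dots> \<le> real (d x)" using leaf.IH[OF r leaf.prems(2)] by (simp add: g_def)
    finally show ?thesis unfolding eq .
  next
    case True
    have "(\<Sum>s\<in>IM S. \<Sum>y\<in>V - s ` S. of_bool ((s(w := y)) r = x) * (g s * (ind A {s u, y} / real (d (s u))))) \<le>
        (\<Sum>s\<in>IM S. \<Sum>y\<in>V. of_bool (y = x) * (g s * (ind A {s u, y} / real (d (s u)))))"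
    proof (rule sum_mono)
      fix s
      show "(\<Sum>y\<in>V - s ` S. of_bool ((s(w := y)) r = x) * (g s * (ind A {s u, y} / real (d (s u))))) \<le>
          (\<Sum>y\<in>V. of_bool (y = x) * (g s * (ind A {s u, y} / real (d (s u)))))"
        unfolding True fun_upd_same using finV g by (intro sum_mono2) auto
    qed
    also have "\<dots> = (\<Sum>s\<in>IM S. g s * (ind A {s u, x} / real (d (s u))))"
    proof (rule sum.cong[OF refl])
      fix s
      have "V \<inter> {y. y = x} = {x}" using leaf.prems by auto
      then show "(\<Sum>y\<in>V. of_bool (y = x) * (g s * (ind A {s u, y} / real (d (s u))))) =
          g s * (ind A {s u, x} / real (d (s u)))"
        using finV by (subst sum_of_bool_mult_eq) (simp_all del: sum_of_bool_mult_eq)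
    qed
    \<comment> \<open>With the root at the new leaf, the sum is split by the image \<open>z\<close>
      of the parent. The induction hypothesis with root \<open>u\<close> gives at most
      \<open>d z\<close>, which cancels \<open>1 / d z\<close> and leaves the number of neighbours
      of \<open>x\<close>.\<close>
    also have "\<dots> = (\<Sum>s\<in>IM S. \<Sum>z\<in>V. of_bool (s u = z) * g s * (ind A {z, x} / real (d z)))"
    proof (rule sum.cong[OF refl])
      fix s assume "s \<in> IM S"
      then have "V \<inter> {z. s u = z} = {s u}" using IM_in[OF _ leaf.hyps(2)] by auto
      then show "g s * (ind A {s u, x} / real (d (s u))) =
          (\<Sum>z\<in>V. of_bool (s u = z) * g s * (ind A {z, x} / real (d z)))"
        unfolding mult.assoc using finV by (subst sum_of_bool_mult_eq) (simp_all del: sum_of_bool_mult_eq)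
    qed
    also have "\<dots> = (\<Sum>z\<in>V. (\<Sum>s\<in>IM S. of_bool (s u = z) * g s) * (ind A {z, x} / real (d z)))"
      by (subst sum.swap) (simp only: sum_distrib_right)
    also have "\<dots> \<le> (\<Sum>z\<in>V. real (d z) * (ind A {z, x} / real (d z)))"
      using leaf.IH[OF leaf.hyps(2)] by (intro sum_mono mult_right_mono) (auto simp: g_def)
    also have "\<dots> = (\<Sum>z\<in>V. ind A {x, z})"
      using d_pos by (intro sum.cong) (auto simp: insert_commute)
    also have "\<dots> = real (d x)" by (rule sum_ind[OF assms(4) leaf.prems(2)])
    finally show ?thesis unfolding eq .
  qed
qed

definition discrepancy :: "nat set \<Rightarrow> nat set set \<Rightarrow> real" where
  "discrepancy S T = (\<Sum>s\<in>IM S. \<bar>avg (\<lambda>A. tree_prod (ind A) T s) - tree_prod p T s\<bar> / psi S T s)"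

text \<open>The error splits into the deviation of the new edge, weighted by the embedded tree, and
  \<open>p e\<close> times the previous error. Summed over the image of the leaf, \<open>p\<close>
  gives the \<open>d (s u)\<close> by which the new weight divides.\<close>

lemma discrepancy_leaf:
  assumes T: "grown_tree S T" "u \<in> S" "w \<notin> S" and k: "card S \<le> k"
  shows "discrepancy (insert w S) (insert {u, w} T) \<le>
    (real k + 4) * sqrt (M * (real n * ln (real n))) + discrepancy S T"
proof -
  define \<delta> where "\<delta> s e = \<bar>avg (\<lambda>A. tree_prod (ind A) T s * (ind A e - p e))\<bar>" for s e
  define \<epsilon> where "\<epsilon> s = \<bar>avg (\<lambda>A. tree_prod (ind A) T s) - tree_prod p T s\<bar>" for s
  have finS: "finite S" using grown_tree_finite[OF T(1)] by auto
  have J: "finite (IM S)" "card (IM S) \<le> n ^ k"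
  proof -
    have "n ^ card S \<le> n ^ k" using k n_ge_2 by (intro power_increasing) auto
    then show "finite (IM S)" "card (IM S) \<le> n ^ k"
      using inj_maps_finite_card[OF finS, of V] finV by auto
  qed
  have su: "s u \<in> V" "d (s u) > 0" if "s \<in> IM S" for s using IM_in[OF that T(2)] d_pos by auto
  have le: "\<bar>avg (\<lambda>A. tree_prod (ind A) T s * ind A e) - tree_prod p T s * p e\<bar> \<le> \<delta> s e + p e * \<epsilon> s" for s e
  proof -
    have "avg (\<lambda>A. tree_prod (ind A) T s * ind A e) - tree_prod p T s * p e =
        avg (\<lambda>A. tree_prod (ind A) T s * (ind A e - p e)) +
        p e * (avg (\<lambda>A. tree_prod (ind A) T s) - tree_prod p T s)"
      by (simp only: right_diff_distrib avg_diff mult.commute[of _ "p e"] avg_cmult)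
    also have "\<bar>\<dots>\<bar> \<le> \<delta> s e + p e * \<epsilon> s"
      unfolding \<delta>_def \<epsilon>_def using p_nonneg[of e] by (intro order.trans[OF abs_triangle_ineq]) (simp add: abs_mult)
    finally show ?thesis .
  qed
  have "discrepancy (insert w S) (insert {u, w} T) =
      (\<Sum>s\<in>IM S. \<Sum>y\<in>V - s ` S. \<bar>avg (\<lambda>A. tree_prod (ind A) T s * ind A {s u, y}) -
          tree_prod p T s * p {s u, y}\<bar> / (psi S T s * real (d (s u))))"
    unfolding discrepancy_def sum_leaf[OF T] tree_prod_leaf[OF T] ..
  also have "\<dots> \<le> (\<Sum>s\<in>IM S. \<Sum>y\<in>V - s ` S. (\<delta> s {s u, y} + p {s u, y} * \<epsilon> s) / (psi S T s * real (d (s u))))"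
    using le psi_nonneg by (intro sum_mono divide_right_mono) auto
  also have "\<dots> \<le> (\<Sum>s\<in>IM S. \<Sum>y\<in>V. (\<delta> s {s u, y} + p {s u, y} * \<epsilon> s) / (psi S T s * real (d (s u))))"
    using psi_nonneg p_nonneg finV
    by (intro sum_mono sum_mono2) (auto simp: \<delta>_def \<epsilon>_def)
  also have "\<dots> = (\<Sum>s\<in>IM S. \<Sum>y\<in>V. \<delta> s {s u, y} / (psi S T s * real (d (s u)))) +
      (\<Sum>s\<in>IM S. \<Sum>y\<in>V. p {s u, y} * \<epsilon> s / (psi S T s * real (d (s u))))"
    by (simp add: add_divide_distrib sum.distrib)
  also have "(\<Sum>s\<in>IM S. \<Sum>y\<in>V. p {s u, y} * \<epsilon> s / (psi S T s * real (d (s u)))) = discrepancy S T"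
    unfolding discrepancy_def
  proof (rule sum.cong[OF refl])
    fix s assume s: "s \<in> IM S"
    have "(\<Sum>y\<in>V. p {s u, y} * \<epsilon> s / (psi S T s * real (d (s u)))) =
        (\<Sum>y\<in>V. p {s u, y}) * (\<epsilon> s / (psi S T s * real (d (s u))))"
      by (simp add: sum_distrib_right sum_divide_distrib)
    then show "(\<Sum>y\<in>V. p {s u, y} * \<epsilon> s / (psi S T s * real (d (s u)))) =
        \<bar>avg (\<lambda>A. tree_prod (ind A) T s) - tree_prod p T s\<bar> / psi S T s"
      using su[OF s] by (simp add: sum_p \<epsilon>_def)
  qed
  also have "(\<Sum>s\<in>IM S. \<Sum>y\<in>V. \<delta> s {s u, y} / (psi S T s * real (d (s u)))) \<le>
      (real k + 4) * sqrt (M * (real n * ln (real n)))"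
  proof -
    \<comment> \<open>The weight of \<open>s\<close> among the embeddings with parent image
      \<open>x\<close>, divided by the bound of \<open>rooted_weight_le\<close> so that the total at
      each \<open>x\<close> is at most 1.\<close>
    define wt where "wt s x A = (of_bool (s u = x) * tree_prod (ind A) T s) / psi S T s / real (d x)" for s x A
    have "(\<Sum>s\<in>IM S. \<Sum>y\<in>V. \<delta> s {s u, y} / (psi S T s * real (d (s u)))) =
        (\<Sum>s\<in>IM S. \<Sum>x\<in>V. of_bool (s u = x) * (\<Sum>e\<in>EE_at x. \<delta> s e) / (psi S T s * real (d x)))"
    proof (rule sum.cong[OF refl])
      fix s assume s: "s \<in> IM S"
      have "\<delta> s e = 0" if "e \<notin> EE" for e
      proof -
        have "avg (\<lambda>A. tree_prod (ind A) T s * (ind A e - p e)) = avg (\<lambda>_. 0)"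
          unfolding avg_def using that p_out
          by (intro arg_cong2[where f = "(/)"] sum.cong) (auto simp: constrained_def)
        then show ?thesis by (simp add: \<delta>_def avg_const)
      qed
      then have "(\<Sum>y\<in>V. \<delta> s {s u, y}) = (\<Sum>e\<in>EE_at (s u). \<delta> s e)"
        using su[OF s] by (intro sum_neighbours) auto
      then have "(\<Sum>y\<in>V. \<delta> s {s u, y} / (psi S T s * real (d (s u)))) =
          (\<Sum>e\<in>EE_at (s u). \<delta> s e) / (psi S T s * real (d (s u)))"
        by (simp flip: sum_divide_distrib)
      also have "\<dots> = (\<Sum>x\<in>V. if s u = x then (\<Sum>e\<in>EE_at x. \<delta> s e) / (psi S T s * real (d x)) else 0)"
        using su[OF s] finV by simp
      also have "\<dots> = (\<Sum>x\<in>V. of_bool (s u = x) * (\<Sum>e\<in>EE_at x. \<delta> s e) / (psi S T s * real (d x)))"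
        by (intro sum.cong) auto
      finally show "(\<Sum>y\<in>V. \<delta> s {s u, y} / (psi S T s * real (d (s u)))) =
        (\<Sum>x\<in>V. of_bool (s u = x) * (\<Sum>e\<in>EE_at x. \<delta> s e) / (psi S T s * real (d x)))" .
    qed
    also have "\<dots> = (\<Sum>s\<in>IM S. \<Sum>x\<in>V. \<Sum>e\<in>EE_at x. \<bar>avg (\<lambda>A. wt s x A * (ind A e - p e))\<bar>)"
    proof (intro sum.cong refl)
      fix s x assume "s \<in> IM S" "x \<in> V"
      have "\<bar>avg (\<lambda>A. wt s x A * (ind A e - p e))\<bar> = of_bool (s u = x) / (psi S T s * real (d x)) * \<delta> s e" for e
      proof -
        have "(\<lambda>A. wt s x A * (ind A e - p e)) =
          (\<lambda>A. of_bool (s u = x) / (psi S T s * real (d x)) * (tree_prod (ind A) T s * (ind A e - p e)))"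
          by (simp add: wt_def fun_eq_iff)
        then show ?thesis using psi_nonneg by (simp only: avg_cmult \<delta>_def) (simp add: abs_mult)
      qed
      then show "of_bool (s u = x) * (\<Sum>e\<in>EE_at x. \<delta> s e) / (psi S T s * real (d x)) =
          (\<Sum>e\<in>EE_at x. \<bar>avg (\<lambda>A. wt s x A * (ind A e - p e))\<bar>)"
        by (simp add: sum_distrib_left sum_divide_distrib)
    qed
    also have "\<dots> = (\<Sum>x\<in>V. \<Sum>s\<in>IM S. \<Sum>e\<in>EE_at x. \<bar>avg (\<lambda>A. wt s x A * (ind A e - p e))\<bar>)"
      by (rule sum.swap)
    also have "\<dots> \<le> (real k + 4) * sqrt (M * (real n * ln (real n)))"
    proof (rule weighted_edge_deviation[OF J])
      show "0 \<le> wt s x A" for s x A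
        unfolding wt_def by (intro divide_nonneg_nonneg mult_nonneg_nonneg tree_prod_nonneg psi_nonneg) auto
      fix x A assume x: "x \<in> V" "A \<in> GG"
      show "(\<Sum>s\<in>IM S. wt s x A) \<le> 1"
        using rooted_weight_le[OF T(1,2) x] d_pos[OF x(1)]
        unfolding wt_def sum_divide_distrib[symmetric] by (simp only: pos_divide_le_eq of_nat_0_less_iff mult_1)
    qed
    finally show ?thesis .
  qed
  finally show ?thesis by simp
qed

text \<open>A single vertex has discrepancy 0, and every leaf adds the same error because
  \<open>k\<close> bounds the sizes of all intermediate trees.\<close>

theorem discrepancy_le:
  assumes "grown_tree S T" "card S \<le> k"
  shows "discrepancy S T \<le> real (card S - 1) * ((real k + 4) * sqrt (M * (real n * ln (real n))))"
  using assms
proof (induction rule: grown_tree.induct)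
  case (root r)
  then show ?case by (simp add: discrepancy_def tree_prod_def avg_const)
next
  case (leaf S T u w)
  have fin: "finite S" "S \<noteq> {}" using grown_tree_finite[OF leaf.hyps(1)] by auto
  then have cS: "card (insert w S) = Suc (card S)" "card S \<ge> 1" using leaf.hyps by (auto simp: card_gt_0_iff Suc_le_eq)
  then have "discrepancy (insert w S) (insert {u, w} T) \<le>
    (real k + 4) * sqrt (M * (real n * ln (real n))) + discrepancy S T"
    using leaf.prems by (intro discrepancy_leaf[OF leaf.hyps]) auto
  also have "discrepancy S T \<le> real (card S - 1) * ((real k + 4) * sqrt (M * (real n * ln (real n))))"
    using leaf.IH leaf.prems cS by simp
  finally show ?case using cS by (simp add: algebra_simps of_nat_diff)
qed

end

section \<open>Return to the stated probabilities\<close>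

lemma tree_indicator_eq:
  assumes "simple_graph {1..k} T"
  shows "tree_indicator s T G = tree_prod (\<lambda>e. of_bool (e \<in> G)) T s"
proof -
  have "T \<subseteq> Pow {1..k}" using assms by (auto simp: simple_graph_def)
  then have fin: "finite T" by (rule finite_subset) simp
  have "(\<forall>u1 u2. {u1, u2} \<in> T \<longrightarrow> {s u1, s u2} \<in> G) \<longleftrightarrow> (\<forall>e\<in>T. s ` e \<in> G)"
  proof
    assume *: "\<forall>u1 u2. {u1, u2} \<in> T \<longrightarrow> {s u1, s u2} \<in> G"
    show "\<forall>e\<in>T. s ` e \<in> G"
    proof
      fix e assume "e \<in> T"
      moreover from this obtain a b where "e = {a, b}" using assms by (auto simp: simple_graph_def)
      ultimately show "s ` e \<in> G" using * by auto
    qed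
  qed force
  then show ?thesis using fin by (auto simp: tree_indicator_def tree_prod_def)
qed

locale degree_sequences = entropy_polytope +
  assumes n_pos: "1 \<le> n1" "1 \<le> n2"
    and D_pos: "\<And>i. i \<in> {1..n1} \<Longrightarrow> 0 < D1 i" "\<And>j. j \<in> {1..n2} \<Longrightarrow> 0 < D2 j"

sublocale degree_sequences \<subseteq> edge_model "bip_set1 n1" "bip_set2 n1 n2" "combined_degrees n1 D1 D2" pe
proof unfold_locales
  show "bip_set1 n1 \<noteq> {}" "bip_set2 n1 n2 \<noteq> {}" using n_pos by (auto simp: bip_set1_def bip_set2_def)
  show "0 < combined_degrees n1 D1 D2 v" if "v \<in> bip_set1 n1 \<union> bip_set2 n1 n2" for v
    using that by (cases rule: V_cases) (use D_pos in \<open>auto simp: combined_degrees_def\<close>)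
qed (use pe_range pe_degree card_constrained_pos uniform_le_edge_prob in \<open>auto intro: less_imp_le simp: pe_def\<close>)

context degree_sequences
begin

lemma V_eq: "V = {1..n1 + n2}"
  by (auto simp: bip_set1_def bip_set2_def)

lemma n_eq: "n = n1 + n2"
  unfolding V_eq by simp

lemma M_eq: "M = real (total_degree n1 n2 D1 D2)"
  unfolding M_def V_eq by (simp add: total_degree_def)

lemma no_inner_edge_iff:
  assumes "\<And>e. e \<in> E \<Longrightarrow> \<exists>u v. e = {u, v} \<and> u \<in> V \<and> v \<in> V"
  shows "no_inner_edge n1 n2 E \<longleftrightarrow> E \<subseteq> EE"
proof
  assume *: "no_inner_edge n1 n2 E"
  show "E \<subseteq> EE"
  proof
    fix e assume e: "e \<in> E"
    then obtain u v where uv: "e = {u, v}" "u \<in> V" "v \<in> V" using assms by blast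
    moreover have "\<not> e \<subseteq> bip_set1 n1" "\<not> e \<subseteq> bip_set2 n1 n2"
      using * e by (auto simp: no_inner_edge_def)
    ultimately have "u \<in> bip_set1 n1 \<and> v \<in> bip_set2 n1 n2 \<or> v \<in> bip_set1 n1 \<and> u \<in> bip_set2 n1 n2"
      by auto
    then show "e \<in> EE" unfolding uv(1) bip_edges_def by (auto simp: insert_commute)
  qed
next
  assume "E \<subseteq> EE"
  then show "no_inner_edge n1 n2 E"
    using disjV unfolding no_inner_edge_def bip_edges_def by blast
qed

lemma bip_graphs_eq: "bip_graphs n1 n2 D1 D2 = GG"
proof -
  have deg: "(\<forall>v\<in>V. vertex_degree G v = combined_degrees n1 D1 D2 v) \<longleftrightarrow>
      (\<forall>i\<in>{1..n1}. vertex_degree G i = D1 i) \<and> (\<forall>j\<in>{1..n2}. vertex_degree G (n1 + j) = D2 j)" for G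
  proof
    assume *: "\<forall>v\<in>V. vertex_degree G v = combined_degrees n1 D1 D2 v"
    have "i \<in> V" if "i \<in> {1..n1}" for i using that by (auto simp: V_eq)
    moreover have "n1 + j \<in> V" if "j \<in> {1..n2}" for j using that by (auto simp: V_eq)
    ultimately show "(\<forall>i\<in>{1..n1}. vertex_degree G i = D1 i) \<and> (\<forall>j\<in>{1..n2}. vertex_degree G (n1 + j) = D2 j)"
      using * by (auto simp: combined_degrees_def)
  next
    assume *: "(\<forall>i\<in>{1..n1}. vertex_degree G i = D1 i) \<and> (\<forall>j\<in>{1..n2}. vertex_degree G (n1 + j) = D2 j)"
    show "\<forall>v\<in>V. vertex_degree G v = combined_degrees n1 D1 D2 v"
    proof
      fix v assume "v \<in> V"
      then show "vertex_degree G v = combined_degrees n1 D1 D2 v"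
        by (cases rule: V_cases) (use * in \<open>auto simp: combined_degrees_def\<close>)
    qed
  qed
  have "simple_graph {1..n1 + n2} G \<and> no_inner_edge n1 n2 G \<longleftrightarrow> G \<subseteq> EE" for G
  proof
    assume "simple_graph {1..n1 + n2} G \<and> no_inner_edge n1 n2 G"
    then show "G \<subseteq> EE"
      using no_inner_edge_iff[of G] unfolding simple_graph_def V_eq[symmetric] by blast
  next
    assume G: "G \<subseteq> EE"
    have "\<exists>u v. e = {u, v} \<and> u \<in> V \<and> v \<in> V \<and> u \<noteq> v" if "e \<in> G" for e
      using G that disjV unfolding bip_edges_def by blast
    then show "simple_graph {1..n1 + n2} G \<and> no_inner_edge n1 n2 G"
      using no_inner_edge_iff[of G] G unfolding simple_graph_def V_eq[symmetric] by blast
  qed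
  then show ?thesis unfolding bip_graphs_def constrained_def deg by auto
qed

lemma uniform_tree_prob_eq:
  assumes "simple_graph {1..k} T"
  shows "uniform_tree_prob n1 n2 D1 D2 s T = avg (\<lambda>A. tree_prod (ind A) T s)"
proof -
  have "GG \<noteq> {}" using card_GG_pos by auto
  then show ?thesis
    unfolding uniform_tree_prob_def uniform_bip_graph_def bip_graphs_eq avg_def
    by (simp add: integral_pmf_of_set finite_constrained tree_indicator_eq[OF assms])
qed

lemma prod_EE: "(\<Prod>e\<in>EE. h e) = (\<Prod>u\<in>UU. h {fst u, n1 + snd u})"
  using prod.reindex_bij_betw[OF bij_edges[unfolded case_prod_unfold], of h] by simp

text \<open>An injective \<open>s\<close> sends different edges of \<open>T\<close> to different
  edges, so the probability is a product. It is written over all index pairs, with factor 1 at those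
  outside the image tree, to match \<open>Pi_pmf\<close>.\<close>

lemma independent_tree_prob_eq:
  assumes T: "simple_graph {1..k} T" and s: "s \<in> inj_maps {1..k} V"
    and inner: "no_inner_edge n1 n2 ((\<lambda>e. s ` e) ` T)"
  shows "independent_tree_prob n1 n2 D1 D2 s T = tree_prod pe T s"
proof -
  let ?sT = "(\<lambda>e. s ` e) ` T"
  have TP: "T \<subseteq> Pow {1..k}" using T by (auto simp: simple_graph_def)
  have "inj_on s {1..k}" using s by (simp add: inj_maps_def)
  then have injT: "inj_on (\<lambda>e. s ` e) T" using TP by (meson inj_on_image_Pow inj_on_subset)
  have sE: "?sT \<subseteq> EE"
  proof (subst no_inner_edge_iff[symmetric])
    fix e assume "e \<in> ?sT"
    then obtain a b where "e = {s a, s b}" "a \<in> {1..k}" "b \<in> {1..k}" using T by (auto simp: simple_graph_def)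
    then show "\<exists>u v. e = {u, v} \<and> u \<in> V \<and> v \<in> V" using s unfolding inj_maps_def by blast
  qed (rule inner)
  define g where "g present = {{i, n1 + j} | i j. i \<in> {1..n1} \<and> j \<in> {1..n2} \<and> present (i, j)}"
    for present :: "nat \<times> nat \<Rightarrow> bool"
  have g: "{i, n1 + j} \<in> g present \<longleftrightarrow> present (i, j)" if "i \<in> {1..n1}" "j \<in> {1..n2}" for i j present
  proof
    assume "{i, n1 + j} \<in> g present"
    then obtain i' j' where "{i, n1 + j} = {i', n1 + j'}" "i' \<in> {1..n1}" "present (i', j')"
      unfolding g_def by blast
    then show "present (i, j)" using edge_eq_iff[OF that(1), of i' j j'] by simp
  next
    assume "present (i, j)"
    then show "{i, n1 + j} \<in> g present" unfolding g_def using that by blast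
  qed
  have "tree_indicator s T (g present) =
      (\<Prod>u\<in>UU. if {fst u, n1 + snd u} \<in> ?sT then of_bool (present u) else 1)" for present
  proof -
    have "tree_indicator s T (g present) = (\<Prod>e\<in>?sT. of_bool (e \<in> g present))"
      using injT by (simp add: tree_indicator_eq[OF T] tree_prod_def prod.reindex)
    also have "\<dots> = (\<Prod>e\<in>EE. if e \<in> ?sT then of_bool (e \<in> g present) else 1)"
      using sE finite_EE by (simp add: prod.inter_restrict[symmetric] Int_absorb1)
    also have "\<dots> = (\<Prod>u\<in>UU. if {fst u, n1 + snd u} \<in> ?sT then of_bool ({fst u, n1 + snd u} \<in> g present) else 1)"
      by (rule prod_EE)
    also have "\<dots> = (\<Prod>u\<in>UU. if {fst u, n1 + snd u} \<in> ?sT then of_bool (present u) else 1)"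
      using g by (intro prod.cong) auto
    finally show ?thesis .
  qed
  then have "independent_tree_prob n1 n2 D1 D2 s T =
      measure_pmf.expectation (Pi_pmf UU False (\<lambda>(i, j). bernoulli_pmf (pm (i, j))))
        (\<lambda>present. \<Prod>u\<in>UU. if {fst u, n1 + snd u} \<in> ?sT then of_bool (present u) else 1)"
    unfolding independent_tree_prob_def independent_bip_graph_def integral_map_pmf g_def[symmetric] by simp
  also have "\<dots> = (\<Prod>u\<in>UU. measure_pmf.expectation (bernoulli_pmf (pm u))
        (\<lambda>b. if {fst u, n1 + snd u} \<in> ?sT then of_bool b else 1))"
    by (subst expectation_prod_Pi_pmf) (auto intro!: integrable_measure_pmf_finite simp: case_prod_unfold)
  also have "\<dots> = (\<Prod>u\<in>UU. if {fst u, n1 + snd u} \<in> ?sT then pe {fst u, n1 + snd u} else 1)"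
  proof (rule prod.cong[OF refl])
    fix u assume u: "u \<in> UU"
    show "measure_pmf.expectation (bernoulli_pmf (pm u)) (\<lambda>b. if {fst u, n1 + snd u} \<in> ?sT then of_bool b else 1) =
        (if {fst u, n1 + snd u} \<in> ?sT then pe {fst u, n1 + snd u} else 1)"
      using max_entropy_interior[OF u] pe_edge[of "fst u" "snd u"] u by auto
  qed
  also have "\<dots> = (\<Prod>e\<in>EE. if e \<in> ?sT then pe e else 1)"
    by (rule prod_EE[symmetric])
  also have "\<dots> = (\<Prod>e\<in>?sT. pe e)"
    using sE finite_EE by (simp add: prod.inter_restrict[symmetric] Int_absorb1)
  also have "\<dots> = tree_prod pe T s" using injT by (simp add: tree_prod_def prod.reindex)
  finally show ?thesis .
qed

lemma tree_discrepancy_le: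
  assumes "k \<ge> 1"
  shows "tree_discrepancy k n1 n2 D1 D2 \<le>
    real (card (labeled_trees k)) * real k * (real k + 4) * (real n * ln (real n) / M) powr (1 / 2)"
proof -
  let ?B = "(real k + 4) * sqrt (M * (real n * ln (real n)))"
  define f where "f s T = \<bar>avg (\<lambda>A. tree_prod (ind A) T s) - tree_prod pe T s\<bar> / psi {1..k} T s" for s T
  have fin: "finite (labeled_trees k)"
    by (rule finite_subset[of _ "Pow (Pow {1..k})"]) (auto simp: labeled_trees_def simple_graph_def)
  have finI: "finite (inj_maps {1..k} V)" using finV by (intro inj_maps_finite_card) auto
  have L: "0 \<le> real n * ln (real n)" using n_ge_2 by simp
  have "(\<Sum>(s, T)\<in>bip_ordered_trees k n1 n2.
        1 / tree_weight k s T (combined_degrees n1 D1 D2) *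
        \<bar>uniform_tree_prob n1 n2 D1 D2 s T - independent_tree_prob n1 n2 D1 D2 s T\<bar>) =
      (\<Sum>(s, T)\<in>bip_ordered_trees k n1 n2. f s T)"
  proof (rule sum.cong[OF refl], clarify)
    fix s T assume "(s, T) \<in> bip_ordered_trees k n1 n2"
    then have "simple_graph {1..k} T" "s \<in> inj_maps {1..k} V" "no_inner_edge n1 n2 ((\<lambda>e. s ` e) ` T)"
      by (auto simp: bip_ordered_trees_def labeled_trees_def injective_maps_def inj_maps_def V_eq)
    then show "1 / tree_weight k s T (combined_degrees n1 D1 D2) *
        \<bar>uniform_tree_prob n1 n2 D1 D2 s T - independent_tree_prob n1 n2 D1 D2 s T\<bar> = f s T"
      by (simp add: f_def uniform_tree_prob_eq independent_tree_prob_eq tree_weight_def psi_def)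
  qed
  \<comment> \<open>The recursion over leaves sums over all injective maps; the terms added here are
    nonnegative.\<close>
  also have "\<dots> \<le> (\<Sum>(s, T)\<in>inj_maps {1..k} V \<times> labeled_trees k. f s T)"
  proof (rule sum_mono2)
    show "bip_ordered_trees k n1 n2 \<subseteq> inj_maps {1..k} V \<times> labeled_trees k"
      by (auto simp: bip_ordered_trees_def injective_maps_def inj_maps_def V_eq)
  qed (use fin finI psi_nonneg in \<open>auto simp: f_def\<close>)
  also have "\<dots> = (\<Sum>T\<in>labeled_trees k. discrepancy {1..k} T)"
    unfolding sum.cartesian_product[symmetric] by (subst sum.swap) (simp add: f_def discrepancy_def)
  also have "\<dots> \<le> (\<Sum>T\<in>labeled_trees k. real k * ?B)"
  proof (rule sum_mono)
    fix T assume "T \<in> labeled_trees k"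
    then have "discrepancy {1..k} T \<le> real (card {1..k} - 1) * ?B"
      using assms by (intro discrepancy_le labeled_tree_grown) auto
    also have "\<dots> \<le> real k * ?B" using L M_pos by (intro mult_right_mono) auto
    finally show "discrepancy {1..k} T \<le> real k * ?B" .
  qed
  also have "\<dots> = real (card (labeled_trees k)) * real k * ?B" by simp
  finally have "tree_discrepancy k n1 n2 D1 D2 \<le> 1 / M * (real (card (labeled_trees k)) * real k * ?B)"
    unfolding tree_discrepancy_def M_eq[symmetric] using M_pos by (intro mult_left_mono) auto
  also have "\<dots> = real (card (labeled_trees k)) * real k * (real k + 4) * (sqrt (M * (real n * ln (real n))) / M)"
    by simp
  also have "sqrt (M * (real n * ln (real n))) / M = sqrt (real n * ln (real n) / M)"
    using M_pos by (simp add: real_sqrt_mult real_sqrt_divide field_simps)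
  also have "\<dots> = (real n * ln (real n) / M) powr (1 / 2)"
    using L M_pos by (simp add: powr_half_sqrt)
  finally show ?thesis .
qed

end

theorem theorem2p30:
  fixes k :: nat
  assumes "k \<ge> 1"
  shows "\<exists>c::real. c > 0 \<and>
    (\<forall>(n1::nat) (n2::nat) (D1 :: nat \<Rightarrow> nat) (D2 :: nat \<Rightarrow> nat).
       n1 \<ge> 1 \<and> n2 \<ge> 1 \<and>
       (\<forall>i\<in>{1..n1}. D1 i > 0) \<and> (\<forall>j\<in>{1..n2}. D2 j > 0) \<and>
       mono_on {1..n1} D1 \<and> mono_on {1..n2} D2 \<and>
       (\<Sum>i\<in>{1..n1}. D1 i) = (\<Sum>j\<in>{1..n2}. D2 j) \<and>
       nonempty_interior n1 n2 D1 D2 \<longrightarrow>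
       tree_discrepancy k n1 n2 D1 D2
         \<le> c * (real (n1 + n2) * ln (real (n1 + n2)) / real (total_degree n1 n2 D1 D2)) powr (1 / 2))"
proof -
  \<comment> \<open>The summand 1 makes \<open>c\<close> positive without exhibiting a tree.\<close>
  define c where "c = real (card (labeled_trees k)) * real k * (real k + 4) + 1"
  have "c > 0" by (auto simp: c_def intro!: add_nonneg_pos)
  moreover have "tree_discrepancy k n1 n2 D1 D2
      \<le> c * (real (n1 + n2) * ln (real (n1 + n2)) / real (total_degree n1 n2 D1 D2)) powr (1 / 2)"
    if "n1 \<ge> 1" "n2 \<ge> 1" "\<forall>i\<in>{1..n1}. D1 i > 0" "\<forall>j\<in>{1..n2}. D2 j > 0"
      "nonempty_interior n1 n2 D1 D2" for n1 n2 D1 D2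
  proof -
    interpret degree_sequences n1 n2 D1 D2
      by unfold_locales (use that in auto)
    let ?X = "(real n * ln (real n) / M) powr (1 / 2)"
    have "tree_discrepancy k n1 n2 D1 D2 \<le> (c - 1) * ?X"
      using tree_discrepancy_le[OF assms] by (simp add: c_def)
    also have "\<dots> \<le> c * ?X" by (intro mult_right_mono) auto
    finally show ?thesis unfolding M_eq n_eq .
  qed
  ultimately show ?thesis by blast
qed

end
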